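(* The index set $\{e : e \text{ is an index of a computable structure that is } \mathbf{0}'\text{-computably bi-embeddably categorical}\}$ is $\Pi^1_1$-complete.
   Context: Computable structures are indexed by natural numbers $e$ via a standard enumeration of (atomic diagrams of) computable structures. Two structures are bi-embeddable ($\approx$) if each embeds isomorphically into the other. A computable structure $\mathcal{S}$ is $\mathbf{d}$-computably bi-embeddably categorical if for every computable $\mathcal{A}\approx\mathcal{S}$ there are $\mathbf{d}$-computable embeddings $\mathcal{A}\hookrightarrow\mathcal{S}$ and $\mathcal{S}\hookrightarrow\mathcal{A}$; here $\mathbf{0}'$ is the degree of the halting problem. *)

theory Defs
  imports Main "HOL-Library.Nat_Bijection"
begin

text \<open>Unary programs acting on natural numbers; tuples are handled via the
Cantor pairing prod_encode / prod_decode. The oracle is a total function nat => nat.\<close>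

datatype prog =
    Zer
  | Suc_p
  | Id_p
  | Orc
  | Fst_p
  | Snd_p
  | Pair_p prog prog
  | Comp_p prog prog
  | Rec_p prog prog
  | Mu_p prog

inductive ev :: "(nat \<Rightarrow> nat) \<Rightarrow> prog \<Rightarrow> nat \<Rightarrow> nat \<Rightarrow> bool" for A where
  ev_Zer: "ev A Zer x 0"
| ev_Suc: "ev A Suc_p x (Suc x)"
| ev_Id: "ev A Id_p x x"
| ev_Orc: "ev A Orc x (A x)"
| ev_Fst: "ev A Fst_p x (fst (prod_decode x))"
| ev_Snd: "ev A Snd_p x (snd (prod_decode x))"
| ev_Pair: "ev A f x y \<Longrightarrow> ev A g x z \<Longrightarrow> ev A (Pair_p f g) x (prod_encode (y, z))"
| ev_Comp: "ev A g x y \<Longrightarrow> ev A f y z \<Longrightarrow> ev A (Comp_p f g) x z"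
| ev_Rec0: "ev A f x y \<Longrightarrow> ev A (Rec_p f g) (prod_encode (x, 0)) y"
| ev_RecS: "ev A (Rec_p f g) (prod_encode (x, n)) y \<Longrightarrow>
            ev A g (prod_encode (x, prod_encode (n, y))) z \<Longrightarrow>
            ev A (Rec_p f g) (prod_encode (x, Suc n)) z"
| ev_Mu: "ev A f (prod_encode (x, n)) 0 \<Longrightarrow>
          (\<forall>m<n. \<exists>y. ev A f (prod_encode (x, m)) (Suc y)) \<Longrightarrow>
          ev A (Mu_p f) x n"

fun enc :: "prog \<Rightarrow> nat" where
  "enc Zer = prod_encode (0, 0)"
| "enc Suc_p = prod_encode (1, 0)"
| "enc Id_p = prod_encode (2, 0)"
| "enc Orc = prod_encode (3, 0)"
| "enc Fst_p = prod_encode (4, 0)"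
| "enc Snd_p = prod_encode (5, 0)"
| "enc (Pair_p f g) = prod_encode (6, prod_encode (enc f, enc g))"
| "enc (Comp_p f g) = prod_encode (7, prod_encode (enc f, enc g))"
| "enc (Rec_p f g) = prod_encode (8, prod_encode (enc f, enc g))"
| "enc (Mu_p f) = prod_encode (9, enc f)"

definition program :: "nat \<Rightarrow> prog" where
  "program e = (if e \<in> range enc then inv enc e else Zer)"

text \<open>Computation without oracle (equivalently, relative to the computable oracle 0).\<close>
abbreviation no_oracle :: "nat \<Rightarrow> nat" where "no_oracle \<equiv> (\<lambda>_. 0)"

definition phi :: "nat \<Rightarrow> nat \<Rightarrow> nat \<Rightarrow> bool" where
  "phi e x y \<longleftrightarrow> ev no_oracle (program e) x y"

definition halting_set :: "nat set" where
  "halting_set = {e. \<exists>y. phi e e y}"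

definition char_fun :: "nat set \<Rightarrow> nat \<Rightarrow> nat" where
  "char_fun X n = (if n \<in> X then 1 else 0)"

definition computable_in :: "nat set \<Rightarrow> (nat \<Rightarrow> nat) \<Rightarrow> bool" where
  "computable_in X g \<longleftrightarrow> (\<exists>p. \<forall>x. ev (char_fun X) p x (g x))"

definition zero_jump_computable :: "(nat \<Rightarrow> nat) \<Rightarrow> bool" where
  "zero_jump_computable g \<longleftrightarrow> computable_in halting_set g"

text \<open>Kleene normal form: S is Pi^1_1 iff there is an oracle program p such that
x \<in> S iff p with oracle f halts on x for every f : nat \<Rightarrow> nat.\<close>
definition Pi11 :: "nat set \<Rightarrow> bool" where
  "Pi11 S \<longleftrightarrow> (\<exists>p. \<forall>x. x \<in> S \<longleftrightarrow> (\<forall>f :: nat \<Rightarrow> nat. \<exists>y. ev f p x y))"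

definition m_reducible :: "nat set \<Rightarrow> nat set \<Rightarrow> bool" where
  "m_reducible T S \<longleftrightarrow> (\<exists>p. \<forall>x. \<exists>y. ev no_oracle p x y \<and> (x \<in> T \<longleftrightarrow> y \<in> S))"

definition Pi11_complete :: "nat set \<Rightarrow> bool" where
  "Pi11_complete S \<longleftrightarrow> Pi11 S \<and> (\<forall>T. Pi11 T \<longrightarrow> m_reducible T S)"

text \<open>Structures with domain nat in the fixed computable relational language having,
for every i and every arity n, an n-ary relation symbol R_(i,n):
  R i xs  means that R_(i, length xs) holds of the tuple xs.\<close>
type_synonym struc = "nat \<Rightarrow> nat list \<Rightarrow> bool"

definition is_embedding :: "(nat \<Rightarrow> nat) \<Rightarrow> struc \<Rightarrow> struc \<Rightarrow> bool" where
  "is_embedding f A B \<longleftrightarrow> inj f \<and> (\<forall>i xs. A i xs \<longleftrightarrow> B i (map f xs))"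

definition bi_embeddable :: "struc \<Rightarrow> struc \<Rightarrow> bool" where
  "bi_embeddable A B \<longleftrightarrow> (\<exists>f. is_embedding f A B) \<and> (\<exists>g. is_embedding g B A)"

text \<open>e is an index of a computable structure: phi_e is a total {0,1}-valued function
(the characteristic function of the atomic diagram).\<close>
definition is_structure_index :: "nat \<Rightarrow> bool" where
  "is_structure_index e \<longleftrightarrow> (\<forall>x. \<exists>y. phi e x y \<and> y \<le> 1)"

definition struct_of :: "nat \<Rightarrow> struc" where
  "struct_of e i xs \<longleftrightarrow> phi e (prod_encode (i, list_encode xs)) 1"

definition zero_jump_cbe_categorical :: "struc \<Rightarrow> bool" where
  "zero_jump_cbe_categorical S \<longleftrightarrow>
     (\<forall>a. is_structure_index a \<and> bi_embeddable (struct_of a) S \<longrightarrow>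
        (\<exists>f. zero_jump_computable f \<and> is_embedding f (struct_of a) S) \<and>
        (\<exists>g. zero_jump_computable g \<and> is_embedding g S (struct_of a)))"

end

theory Submission
  imports Defs
begin

text \<open>
  For a computable tree of finite sequences, let every node \<open>\<sigma>\<close> be an equivalence class (a block)
  containing one element labelled \<open>\<rho>\<close> for each prefix \<open>\<rho>\<close> of \<open>\<sigma>\<close>. A self-embedding of this
  structure moves each block to a block of an extension; since it is injective on blocks, moving one
  block forces an infinite path. If the tree is well-founded, the structure is therefore rigid under
  self-embeddings, every bi-embeddable copy is isomorphic to it, and the unique isomorphism is
  computable from the halting problem, which recognizes the longest label of a block. If there is a
  path, then shifting along it embeds the structure into the one without the root, and any such
  embedding computes a path. So it remains to attach to each \<open>\<Pi>\<^sup>1\<^sub>1\<close> question a tree none of whose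
  paths is computable from the halting problem, which is achieved by diagonalization.
\<close>

text \<open>For membership in \<open>Pi11\<close>, bi-embeddability stands in a hypothesis, so its
  existential function quantifiers become universal. The embeddings demanded in the conclusion are
  given by programs and cost only number quantifiers, and the halting problem is pinned down by an
  arithmetical condition on one more function variable. For hardness, an embedding preserves and
  reflects each unary label, so a node represented by a single labelled element could never move.
  Spreading the labels of all prefixes over a block leaves only an inclusion between the label sets
  of a block and its image, which is the prefix order. The obstacle is that a tree with paths may
  have computable ones, and then reading a path off an embedding contradicts nothing; hence the
  diagonalization. The copy that forces a block to move arises by deleting the number 0, which codes
  the only element of the root's block.\<close>

abbreviation pair_code :: "nat \<Rightarrow> nat \<Rightarrow> nat" ("\<langle>_,/ _\<rangle>") where
  "\<langle>x, y\<rangle> \<equiv> prod_encode (x, y)"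

abbreviation pfst :: "nat \<Rightarrow> nat" where "pfst z \<equiv> fst (prod_decode z)"
abbreviation psnd :: "nat \<Rightarrow> nat" where "psnd z \<equiv> snd (prod_decode z)"

lemma pair_code_collapse [simp]: "\<langle>pfst z, psnd z\<rangle> = z"
  by (metis prod.collapse prod_decode_inverse)

lemma pair_code_eq_iff: "\<langle>x, y\<rangle> = z \<longleftrightarrow> x = pfst z \<and> y = psnd z"
  by (metis fst_conv pair_code_collapse prod_encode_inverse snd_conv)

section \<open>Computable functionals\<close>

inductive_cases ev_ZerE: "ev A Zer x y"
inductive_cases ev_SucE: "ev A Suc_p x y"
inductive_cases ev_IdE: "ev A Id_p x y"
inductive_cases ev_OrcE: "ev A Orc x y"
inductive_cases ev_FstE: "ev A Fst_p x y"
inductive_cases ev_SndE: "ev A Snd_p x y"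
inductive_cases ev_PairE: "ev A (Pair_p f g) x y"
inductive_cases ev_CompE: "ev A (Comp_p f g) x y"
inductive_cases ev_RecE: "ev A (Rec_p f g) x y"
inductive_cases ev_MuE: "ev A (Mu_p f) x y"

lemma ev_deterministic: "ev A p x y \<Longrightarrow> ev A p x z \<Longrightarrow> y = z"
proof (induction arbitrary: z rule: ev.induct)
  case (ev_Pair f x y g w)
  then show ?case by (metis ev_PairE)
next
  case (ev_Comp g x y f w)
  then show ?case by (metis ev_CompE)
next
  case (ev_Rec0 f x y g)
  from ev_Rec0.prems show ?case by (rule ev_RecE) (auto dest: ev_Rec0.IH)
next
  case (ev_RecS f g x n y w)
  from ev_RecS.prems show ?case by (rule ev_RecE) (auto dest: ev_RecS.IH)
next
  case (ev_Mu f x n)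
  from ev_Mu.prems obtain fz: "ev A f \<langle>x, z\<rangle> 0" and
    less: "\<And>m. m < z \<Longrightarrow> \<exists>y. ev A f \<langle>x, m\<rangle> (Suc y)"
    by (auto elim: ev_MuE)
  show ?case
  proof (rule linorder_cases[of n z])
    assume "n < z" then show ?thesis using less ev_Mu.IH(1) by blast
  next
    assume "z < n" then show ?thesis using ev_Mu.IH(2) fz by (metis nat.distinct(1))
  qed
qed (auto elim: ev_ZerE ev_SucE ev_IdE ev_OrcE ev_FstE ev_SndE)

text \<open>One program must serve all oracles in \<open>\<O>\<close>: \<open>UNIV\<close> gives
  computable functionals, \<open>{halting_oracle}\<close> computability from the halting problem and
  \<open>{no_oracle}\<close> plain computability, so each closure rule is proved once.\<close>

definition recf :: "(nat \<Rightarrow> nat) set \<Rightarrow> ((nat \<Rightarrow> nat) \<Rightarrow> nat \<Rightarrow> nat) \<Rightarrow> bool" where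
  "recf \<O> F \<longleftrightarrow> (\<exists>p. \<forall>f\<in>\<O>. \<forall>x. ev f p x (F f x))"

definition recp :: "(nat \<Rightarrow> nat) set \<Rightarrow> ((nat \<Rightarrow> nat) \<Rightarrow> nat \<Rightarrow> bool) \<Rightarrow> bool" where
  "recp \<O> P \<longleftrightarrow> recf \<O> (\<lambda>f x. of_bool (P f x))"

named_theorems rec_intros

lemma recf_cong: "(\<And>f x. f \<in> \<O> \<Longrightarrow> F f x = G f x) \<Longrightarrow> recf \<O> F \<longleftrightarrow> recf \<O> G"
  by (simp add: recf_def)

lemma recf_mono: "recf \<O> F \<Longrightarrow> \<O>' \<subseteq> \<O> \<Longrightarrow> recf \<O>' F"
  unfolding recf_def by blast

lemma recp_mono: "recp \<O> P \<Longrightarrow> \<O>' \<subseteq> \<O> \<Longrightarrow> recp \<O>' P"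
  unfolding recp_def by (rule recf_mono)

fun const_prog :: "nat \<Rightarrow> prog" where
  "const_prog 0 = Zer"
| "const_prog (Suc n) = Comp_p Suc_p (const_prog n)"

lemma ev_const_prog: "ev A (const_prog n) x n"
  by (induction n) (auto intro: ev.intros)

lemma recf_const [rec_intros]: "recf \<O> (\<lambda>f x. c)"
  unfolding recf_def using ev_const_prog by blast

lemma recf_id [rec_intros]: "recf \<O> (\<lambda>f x. x)"
  unfolding recf_def by (rule exI[of _ Id_p]) (simp add: ev_Id)

lemma recf_comp: "recf \<O> G \<Longrightarrow> recf \<O> F \<Longrightarrow> recf \<O> (\<lambda>f x. G f (F f x))"
  unfolding recf_def by (meson ev_Comp)

lemma recf_Suc [rec_intros]: "recf \<O> F \<Longrightarrow> recf \<O> (\<lambda>f x. Suc (F f x))"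
  using recf_comp[of \<O> "\<lambda>f. Suc" F] ev_Suc unfolding recf_def by blast

lemma recf_oracle [rec_intros]: "recf \<O> F \<Longrightarrow> recf \<O> (\<lambda>f x. f (F f x))"
  using recf_comp[of \<O> "\<lambda>f. f" F] ev_Orc unfolding recf_def by blast

lemma recf_fst [rec_intros]: "recf \<O> F \<Longrightarrow> recf \<O> (\<lambda>f x. pfst (F f x))"
  using recf_comp[of \<O> "\<lambda>f. pfst" F] ev_Fst unfolding recf_def by blast

lemma recf_snd [rec_intros]: "recf \<O> F \<Longrightarrow> recf \<O> (\<lambda>f x. psnd (F f x))"
  using recf_comp[of \<O> "\<lambda>f. psnd" F] ev_Snd unfolding recf_def by blast

lemma recf_pair [rec_intros]: "recf \<O> F \<Longrightarrow> recf \<O> G \<Longrightarrow> recf \<O> (\<lambda>f x. \<langle>F f x, G f x\<rangle>)"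
  unfolding recf_def by (meson ev_Pair)

text \<open>\<open>Rec_p\<close> hands its step program the parameter, the counter and the previous
  value as a nested pair; the second assumption asks for computability of \<open>S\<close> in this
  form.\<close>

lemma recf_rec [rec_intros]:
  assumes "recf \<O> B" "recf \<O> (\<lambda>f z. S f (pfst z) (pfst (psnd z)) (psnd (psnd z)))" "recf \<O> N"
  shows "recf \<O> (\<lambda>f x. rec_nat (B f x) (S f x) (N f x))"
proof -
  obtain b s n where b: "\<And>f x. f \<in> \<O> \<Longrightarrow> ev f b x (B f x)" and
    s: "\<And>f z. f \<in> \<O> \<Longrightarrow> ev f s z (S f (pfst z) (pfst (psnd z)) (psnd (psnd z)))" and
    n: "\<And>f x. f \<in> \<O> \<Longrightarrow> ev f n x (N f x)"
    using assms unfolding recf_def by metis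
  have "ev f (Rec_p b s) \<langle>x, k\<rangle> (rec_nat (B f x) (S f x) k)" if "f \<in> \<O>" for f x k
  proof (induction k)
    case 0
    then show ?case using b[OF that] by (simp add: ev_Rec0)
  next
    case (Suc k)
    then show ?case using s[OF that, of "\<langle>x, \<langle>k, rec_nat (B f x) (S f x) k\<rangle>\<rangle>"]
      by (simp add: ev_RecS)
  qed
  then have "\<forall>f\<in>\<O>. \<forall>x. ev f (Comp_p (Rec_p b s) (Pair_p Id_p n)) x (rec_nat (B f x) (S f x) (N f x))"
    using n by (blast intro: ev.intros)
  then show ?thesis unfolding recf_def by blast
qed

lemma recf_pred [rec_intros]: 
  assumes "recf \<O> F" shows "recf \<O> (\<lambda>f x. F f x - 1)"
proof -
  have "recf \<O> (\<lambda>f x. rec_nat 0 (\<lambda>k r. k) (F f x))" by (intro rec_intros assms)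
  moreover have "rec_nat 0 (\<lambda>k r. k) n = n - 1" for n :: nat by (cases n) auto
  ultimately show ?thesis by simp
qed

lemma recf_plus [rec_intros]:
  assumes "recf \<O> F" "recf \<O> G" shows "recf \<O> (\<lambda>f x. F f x + G f x)"
proof -
  have "recf \<O> (\<lambda>f x. rec_nat (F f x) (\<lambda>k r. Suc r) (G f x))" by (intro rec_intros assms)
  moreover have "rec_nat m (\<lambda>k r. Suc r) n = m + n" for m n :: nat by (induction n) auto
  ultimately show ?thesis by simp
qed

lemma recf_minus [rec_intros]:
  assumes "recf \<O> F" "recf \<O> G" shows "recf \<O> (\<lambda>f x. F f x - G f x)"
proof -
  have "recf \<O> (\<lambda>f x. rec_nat (F f x) (\<lambda>k r. r - 1) (G f x))" by (intro rec_intros assms)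
  moreover have "rec_nat m (\<lambda>k r. r - 1) n = m - n" for m n :: nat by (induction n) auto
  ultimately show ?thesis by simp
qed

lemma recf_times [rec_intros]:
  assumes "recf \<O> F" "recf \<O> G" shows "recf \<O> (\<lambda>f x. F f x * G f x)"
proof -
  have "recf \<O> (\<lambda>f x. rec_nat 0 (\<lambda>k r. r + F f x) (G f x))" by (intro rec_intros recf_comp[OF assms(1)] assms)
  moreover have "rec_nat 0 (\<lambda>k r. r + m) n = m * n" for m n :: nat by (induction n) auto
  ultimately show ?thesis by simp
qed

lemma recf_of_bool [rec_intros]: "recp \<O> P \<Longrightarrow> recf \<O> (\<lambda>f x. of_bool (P f x))"
  by (simp add: recp_def)

lemma recf_if [rec_intros]:
  assumes "recp \<O> P" "recf \<O> F" "recf \<O> G" shows "recf \<O> (\<lambda>f x. if P f x then F f x else G f x)"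
proof -
  have "recf \<O> (\<lambda>f x. rec_nat (G f x) (\<lambda>k r. F f x) (of_bool (P f x)))"
    by (intro rec_intros recf_comp[OF assms(2)] assms)
  moreover have "rec_nat b (\<lambda>k r. a) (of_bool c) = (if c then a else b)" for a b :: nat and c by simp
  ultimately show ?thesis by simp
qed

lemma recf_funpow [rec_intros]:
  assumes "recf \<O> B" "recf \<O> (\<lambda>f z. S f (pfst z) (psnd z))" "recf \<O> N"
  shows "recf \<O> (\<lambda>f x. (S f x ^^ N f x) (B f x))"
proof -
  have "recf \<O> (\<lambda>f x. rec_nat (B f x) (\<lambda>k r. S f x r) (N f x))"
    using recf_comp[OF assms(2), of "\<lambda>f z. \<langle>pfst z, psnd (psnd z)\<rangle>"]
    by (intro rec_intros assms) (simp add: rec_intros)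
  moreover have "rec_nat b (\<lambda>k r. s r) n = (s ^^ n) b" for b n :: nat and s by (induction n) auto
  ultimately show ?thesis by simp
qed

lemma recp_comp: "recp \<O> P \<Longrightarrow> recf \<O> F \<Longrightarrow> recp \<O> (\<lambda>f x. P f (F f x))"
  unfolding recp_def by (rule recf_comp)

lemma recp_not [rec_intros]:
  assumes "recp \<O> P" shows "recp \<O> (\<lambda>f x. \<not> P f x)"
proof -
  have "recf \<O> (\<lambda>f x. 1 - of_bool (P f x))" by (intro rec_intros assms)
  moreover have "1 - of_bool b = (of_bool (\<not> b) :: nat)" for b by simp
  ultimately show ?thesis by (simp add: recp_def)
qed

lemma recp_conj [rec_intros]:
  assumes "recp \<O> P" "recp \<O> Q" shows "recp \<O> (\<lambda>f x. P f x \<and> Q f x)"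
proof -
  have "recf \<O> (\<lambda>f x. of_bool (P f x) * of_bool (Q f x))" by (intro rec_intros assms)
  then show ?thesis by (simp add: recp_def of_bool_conj)
qed

lemma recp_disj [rec_intros]:
  assumes "recp \<O> P" "recp \<O> Q" shows "recp \<O> (\<lambda>f x. P f x \<or> Q f x)"
proof -
  have "recp \<O> (\<lambda>f x. \<not> (\<not> P f x \<and> \<not> Q f x))" by (intro rec_intros assms)
  then show ?thesis by simp
qed

lemma recp_eq_0:
  assumes "recf \<O> F" shows "recp \<O> (\<lambda>f x. F f x = 0)"
proof -
  have "recf \<O> (\<lambda>f x. 1 - F f x)" by (intro rec_intros assms)
  moreover have "1 - n = of_bool (n = 0)" for n :: nat by (cases n) auto
  ultimately show ?thesis by (simp add: recp_def)
qed

lemma recp_le [rec_intros]: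
  assumes "recf \<O> F" "recf \<O> G" shows "recp \<O> (\<lambda>f x. F f x \<le> G f x)"
proof -
  have "recp \<O> (\<lambda>f x. F f x - G f x = 0)" by (intro recp_eq_0 rec_intros assms)
  then show ?thesis by simp
qed

lemma recp_less [rec_intros]:
  assumes "recf \<O> F" "recf \<O> G" shows "recp \<O> (\<lambda>f x. F f x < G f x)"
proof -
  have "recp \<O> (\<lambda>f x. Suc (F f x) \<le> G f x)" by (intro rec_intros assms)
  then show ?thesis by (simp add: Suc_le_eq)
qed

lemma recp_eq [rec_intros]:
  assumes "recf \<O> F" "recf \<O> G" shows "recp \<O> (\<lambda>f x. F f x = G f x)"
proof -
  have "recp \<O> (\<lambda>f x. F f x \<le> G f x \<and> G f x \<le> F f x)" by (intro rec_intros assms)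
  then show ?thesis by (simp add: order_eq_iff)
qed

lemma recp_ball_less [rec_intros]:
  assumes "recp \<O> (\<lambda>f z. P f (pfst z) (psnd z))" "recf \<O> N"
  shows "recp \<O> (\<lambda>f x. \<forall>k<N f x. P f x k)"
proof -
  have "recf \<O> (\<lambda>f x. rec_nat 1 (\<lambda>k r. of_bool (P f x k) * r) (N f x))"
    using recp_comp[OF assms(1), of "\<lambda>f z. \<langle>pfst z, pfst (psnd z)\<rangle>"]
    by (intro rec_intros assms) (simp add: rec_intros)
  moreover have "rec_nat 1 (\<lambda>k r. of_bool (Q k) * r) n = (of_bool (\<forall>k<n. Q k) :: nat)" for Q n
    by (induction n) (auto simp: less_Suc_eq)
  ultimately show ?thesis by (simp add: recp_def)
qed

lemma recp_bex_less [rec_intros]: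
  assumes "recp \<O> (\<lambda>f z. P f (pfst z) (psnd z))" "recf \<O> N"
  shows "recp \<O> (\<lambda>f x. \<exists>k<N f x. P f x k)"
proof -
  have "recp \<O> (\<lambda>f x. \<not> (\<forall>k<N f x. \<not> P f x k))" by (intro rec_intros assms)
  then show ?thesis by simp
qed

lemma recp_ball_le [rec_intros]:
  assumes "recp \<O> (\<lambda>f z. P f (pfst z) (psnd z))" "recf \<O> N"
  shows "recp \<O> (\<lambda>f x. \<forall>k\<le>N f x. P f x k)"
proof -
  have "recp \<O> (\<lambda>f x. \<forall>k<Suc (N f x). P f x k)" by (intro rec_intros assms)
  then show ?thesis by (simp add: less_Suc_eq_le)
qed

text \<open>\<open>Mu_p\<close> looks for the value 0, hence the negated characteristic
  function.\<close>

lemma ev_Mu_Least: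
  assumes "\<And>k. ev A p \<langle>x, k\<rangle> (of_bool (\<not> P k))" "\<exists>k. P k"
  shows "ev A (Mu_p p) x (LEAST k. P k)"
proof (rule ev_Mu)
  show "ev A p \<langle>x, LEAST k. P k\<rangle> 0"
    using assms(1)[of "LEAST k. P k"] LeastI_ex[OF assms(2)] by simp
  show "\<forall>m<LEAST k. P k. \<exists>y. ev A p \<langle>x, m\<rangle> (Suc y)"
  proof (intro allI impI)
    fix m assume "m < (LEAST k. P k)"
    then have "\<not> P m" by (rule not_less_Least)
    then show "\<exists>y. ev A p \<langle>x, m\<rangle> (Suc y)" using assms(1)[of m] by auto
  qed
qed

lemma recf_Least:
  assumes "recp \<O> (\<lambda>f z. P f (pfst z) (psnd z))" "\<And>f x. f \<in> \<O> \<Longrightarrow> \<exists>k. P f x k"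
  shows "recf \<O> (\<lambda>f x. LEAST k. P f x k)"
proof -
  have "recp \<O> (\<lambda>f z. \<not> P f (pfst z) (psnd z))" by (intro rec_intros assms)
  then obtain p where p: "\<forall>f\<in>\<O>. \<forall>z. ev f p z (of_bool (\<not> P f (pfst z) (psnd z)))"
    unfolding recp_def recf_def by blast
  have "ev f (Mu_p p) x (LEAST k. P f x k)" if "f \<in> \<O>" for f x
    using p[rule_format, OF that, of "\<langle>x, _\<rangle>"] assms(2)[OF that] by (intro ev_Mu_Least) auto
  then show ?thesis unfolding recf_def by blast
qed

section \<open>Codes of finite sequences\<close>

text \<open>In \<open>list_encode\<close> the empty list is 0 and a nonempty one is the successor of
  a pair of head and tail, so subtracting 1 exposes the pair. As \<open>tlc\<close> fixes 0,
  iterating it past the end is harmless.\<close>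

definition tlc :: "nat \<Rightarrow> nat" where "tlc c = psnd (c - 1)"
definition nthc :: "nat \<Rightarrow> nat \<Rightarrow> nat" where "nthc c j = pfst ((tlc ^^ j) c - 1)"
definition lenc :: "nat \<Rightarrow> nat" where "lenc c = length (list_decode c)"
definition restr :: "(nat \<Rightarrow> nat) \<Rightarrow> nat \<Rightarrow> nat" where "restr f t = list_encode (map f [0..<t])"

lemma tlc_list_encode: "tlc (list_encode xs) = list_encode (tl xs)"
proof (cases xs)
  case Nil
  have "psnd 0 = 0" by (metis le_zero_eq le_prod_encode_2 pair_code_collapse)
  then show ?thesis using Nil by (simp add: tlc_def)
qed (simp add: tlc_def)

lemma tlc_pow_list_encode: "(tlc ^^ j) (list_encode xs) = list_encode (drop j xs)"
  by (induction j) (simp_all add: tlc_list_encode drop_Suc tl_drop)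

lemma nthc_list_encode: "j < length xs \<Longrightarrow> nthc (list_encode xs) j = xs ! j"
  unfolding nthc_def tlc_pow_list_encode by (simp add: Cons_nth_drop_Suc[symmetric])

lemma nthc_nth: "j < lenc c \<Longrightarrow> nthc c j = list_decode c ! j"
  by (metis lenc_def list_decode_inverse nthc_list_encode)

lemma lenc_list_encode [simp]: "lenc (list_encode xs) = length xs"
  by (simp add: lenc_def)

lemma lenc_restr [simp]: "lenc (restr f t) = t"
  by (simp add: restr_def)

lemma nthc_restr [simp]: "j < t \<Longrightarrow> nthc (restr f t) j = f j"
  by (simp add: restr_def nthc_list_encode)

lemma code_eqI: "lenc c = lenc d \<Longrightarrow> (\<And>j. j < lenc c \<Longrightarrow> nthc c j = nthc d j) \<Longrightarrow> c = d"
  by (metis lenc_def list_decode_inverse nthc_nth nth_equalityI)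

lemma restr_nthc_lenc [simp]: "restr (nthc c) (lenc c) = c"
  by (rule code_eqI) auto

lemma restr_cong: "(\<And>j. j < t \<Longrightarrow> f j = g j) \<Longrightarrow> restr f t = restr g t"
  by (rule code_eqI) auto

lemma lenc_Least: "lenc c = (LEAST j. (tlc ^^ j) c = 0)"
proof -
  have "(tlc ^^ j) c = 0 \<longleftrightarrow> lenc c \<le> j" for j
    using tlc_pow_list_encode[of j "list_decode c"]
    by (metis drop_eq_Nil lenc_def list_decode.simps(1) list_decode_inverse list_encode.simps(1) list_encode_inverse)
  then have "(LEAST j. (tlc ^^ j) c = 0) = lenc c" by (intro Least_equality) auto
  then show ?thesis by (rule sym)
qed

lemma recf_tlc [rec_intros]: "recf \<O> F \<Longrightarrow> recf \<O> (\<lambda>f x. tlc (F f x))"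
  unfolding tlc_def by (intro rec_intros)

lemma recf_nthc [rec_intros]: "recf \<O> F \<Longrightarrow> recf \<O> G \<Longrightarrow> recf \<O> (\<lambda>f x. nthc (F f x) (G f x))"
  unfolding nthc_def by (intro rec_intros)

lemma recf_lenc [rec_intros]: "recf \<O> F \<Longrightarrow> recf \<O> (\<lambda>f x. lenc (F f x))"
proof (rule recf_comp[of \<O> "\<lambda>f. lenc"])
  have "\<exists>j. (tlc ^^ j) c = 0" for c
    by (metis drop_all dual_order.refl list_decode_inverse list_encode.simps(1) tlc_pow_list_encode)
  then show "recf \<O> (\<lambda>f. lenc)"
    unfolding lenc_Least by (intro recf_Least rec_intros) 
qed

text \<open>Consing builds the list from its last entry backwards, so step \<open>k\<close>
  contributes \<open>f (t - Suc k)\<close>.\<close>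

lemma restr_rec: "restr f t = rec_nat 0 (\<lambda>k r. Suc \<langle>f (t - Suc k), r\<rangle>) t"
proof -
  have "k \<le> t \<Longrightarrow> rec_nat 0 (\<lambda>k r. Suc \<langle>f (t - Suc k), r\<rangle>) k = list_encode (map f [t - k..<t])" for k
  proof (induction k)
    case (Suc k)
    then have "[t - Suc k..<t] = (t - Suc k) # [t - k..<t]"
      using Suc.prems by (simp add: upt_conv_Cons Suc_diff_Suc)
    then show ?case using Suc by simp
  qed simp
  from this[of t] show ?thesis by (simp add: restr_def)
qed

lemma recf_restr [rec_intros]:
  assumes "recf \<O> (\<lambda>f z. H f (pfst z) (psnd z))" "recf \<O> N"
  shows "recf \<O> (\<lambda>f x. restr (H f x) (N f x))"
proof -
  have H: "recf \<O> (\<lambda>f z. H f (A f z) (B f z))" if "recf \<O> A" "recf \<O> B" for A B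
    using recf_comp[OF assms(1), of "\<lambda>f z. \<langle>A f z, B f z\<rangle>"] that by (simp add: rec_intros)
  show ?thesis unfolding restr_rec by (intro rec_intros H recf_comp[OF assms(2)] assms)
qed

section \<open>Kleene normal form\<close>

lemma inj_enc: "inj enc"
proof (rule injI)
  fix p q :: prog
  assume "enc p = enc q"
  then show "p = q"
  proof (induction p arbitrary: q)
    case Zer then show ?case by (cases q) auto
  next
    case Suc_p then show ?case by (cases q) auto
  next
    case Id_p then show ?case by (cases q) auto
  next
    case Orc then show ?case by (cases q) auto
  next
    case Fst_p then show ?case by (cases q) auto
  next
    case Snd_p then show ?case by (cases q) auto
  next
    case (Pair_p p1 p2) then show ?case by (cases q) auto
  next
    case (Comp_p p1 p2) then show ?case by (cases q) auto
  next
    case (Rec_p p1 p2) then show ?case by (cases q) auto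
  next
    case (Mu_p p) then show ?case by (cases q) auto
  qed
qed

section \<open>Deciding which numbers code programs\<close>

lemma program_enc [simp]: "program (enc p) = p"
  by (simp add: program_def inj_enc)

text \<open>\<open>program\<close> reads every number outside \<open>range enc\<close> as
  \<open>Zer\<close>, so a universal machine has to decide this set. The right-hand side recurs only
  under the tags 6 to 9, where a positive tag makes the components smaller than
  \<open>k\<close>.\<close>

lemma range_enc_iff:
  "k \<in> range enc \<longleftrightarrow> pfst k \<le> 5 \<and> psnd k = 0 \<or>
     (pfst k = 6 \<or> pfst k = 7 \<or> pfst k = 8) \<and> pfst (psnd k) \<in> range enc \<and> psnd (psnd k) \<in> range enc \<or>
     pfst k = 9 \<and> psnd k \<in> range enc" (is "_ \<longleftrightarrow> ?R k")
proof
  assume "k \<in> range enc"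
  then obtain p where "k = enc p" by blast
  then show "?R k" by (cases p) auto
next
  assume k: "?R k"
  consider "pfst k = 0" "psnd k = 0" | "pfst k = 1" "psnd k = 0" | "pfst k = 2" "psnd k = 0"
    | "pfst k = 3" "psnd k = 0" | "pfst k = 4" "psnd k = 0" | "pfst k = 5" "psnd k = 0"
    | f g where "pfst k = 6" "psnd k = \<langle>enc f, enc g\<rangle>" | f g where "pfst k = 7" "psnd k = \<langle>enc f, enc g\<rangle>"
    | f g where "pfst k = 8" "psnd k = \<langle>enc f, enc g\<rangle>" | f where "pfst k = 9" "psnd k = enc f"
  proof -
    have "n \<le> 5 \<Longrightarrow> n = 0 \<or> n = 1 \<or> n = 2 \<or> n = 3 \<or> n = 4 \<or> n = 5" for n :: nat by auto
    then show ?thesis using k that pair_code_eq_iff by (smt (verit) image_iff)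
  qed
  then have "\<exists>p. enc p = \<langle>pfst k, psnd k\<rangle>"
  proof cases
    case 1 then show ?thesis by (intro exI[of _ Zer]) simp
  next
    case 2 then show ?thesis by (intro exI[of _ Suc_p]) simp
  next
    case 3 then show ?thesis by (intro exI[of _ Id_p]) simp
  next
    case 4 then show ?thesis by (intro exI[of _ Orc]) simp
  next
    case 5 then show ?thesis by (intro exI[of _ Fst_p]) simp
  next
    case 6 then show ?thesis by (intro exI[of _ Snd_p]) simp
  next
    case (7 f g) then show ?thesis by (intro exI[of _ "Pair_p f g"]) simp
  next
    case (8 f g) then show ?thesis by (intro exI[of _ "Comp_p f g"]) simp
  next
    case (9 f g) then show ?thesis by (intro exI[of _ "Rec_p f g"]) simp
  next
    case (10 f) then show ?thesis by (intro exI[of _ "Mu_p f"]) simp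
  qed
  then show "k \<in> range enc" by (metis pair_code_collapse rangeI)
qed

lemma psnd_less:
  assumes "0 < pfst k" shows "psnd k < k"
proof -
  obtain a b where k: "k = \<langle>a, b\<rangle>" by (metis pair_code_collapse)
  have "n \<le> triangle n" for n by (induction n) auto
  from this[of "a + b"] have "a + b \<le> k" by (simp add: k prod_encode_def)
  then show ?thesis using assms by (simp add: k)
qed

lemma psnd_le: "psnd k \<le> k"
  by (metis le_prod_encode_2 pair_code_collapse)

lemma pfst_le: "pfst k \<le> k"
  by (metis le_prod_encode_1 pair_code_collapse)

text \<open>Course-of-values recursion: \<open>code_table n\<close> lists the truth values for \<open>n - 1, \<dots>, 0\<close>, the
  most recent one first.\<close>

definition code_step :: "nat \<Rightarrow> nat \<Rightarrow> bool" where
  "code_step k r \<longleftrightarrow> pfst k \<le> 5 \<and> psnd k = 0 \<or>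
     (pfst k = 6 \<or> pfst k = 7 \<or> pfst k = 8) \<and>
       nthc r (k - Suc (pfst (psnd k))) = 1 \<and> nthc r (k - Suc (psnd (psnd k))) = 1 \<or>
     pfst k = 9 \<and> nthc r (k - Suc (psnd k)) = 1"

definition code_table :: "nat \<Rightarrow> nat" where
  "code_table n = rec_nat 0 (\<lambda>k r. Suc \<langle>of_bool (code_step k r), r\<rangle>) n"

lemma code_table: "code_table n = list_encode (rev (map (\<lambda>j. of_bool (j \<in> range enc)) [0..<n]))"
proof (induction n)
  case (Suc n)
  have look: "nthc (code_table n) (n - Suc j) = 1 \<longleftrightarrow> j \<in> range enc" if "j < n" for j
    unfolding Suc using that by (subst nthc_list_encode) (auto simp: rev_nth)
  have "psnd n < n \<and> pfst (psnd n) < n \<and> psnd (psnd n) < n" if "0 < pfst n"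
    using psnd_less[OF that] le_less_trans pfst_le psnd_le by blast
  then have "code_step n (code_table n) \<longleftrightarrow> n \<in> range enc"
    unfolding code_step_def range_enc_iff[of n] using look by (smt (verit) zero_less_numeral)
  then show ?case using Suc by (simp add: code_table_def)
qed (simp add: code_table_def)

lemma range_enc_iff_table: "k \<in> range enc \<longleftrightarrow> nthc (code_table (Suc k)) 0 = 1"
  unfolding code_table by (subst nthc_list_encode) auto

lemma recp_range_enc [rec_intros]: "recf \<O> F \<Longrightarrow> recp \<O> (\<lambda>f x. F f x \<in> range enc)"
proof (rule recp_comp[of \<O> "\<lambda>f k. k \<in> range enc"])
  show "recp \<O> (\<lambda>f k. k \<in> range enc)"
    unfolding range_enc_iff_table code_table_def code_step_def by (intro rec_intros)
qed

section \<open>Derivations as finite certificates of evaluation\<close>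

abbreviation step_code :: "nat \<Rightarrow> nat \<Rightarrow> nat \<Rightarrow> nat" where
  "step_code e x y \<equiv> \<langle>e, \<langle>x, y\<rangle>\<rangle>"

text \<open>\<open>justified R M v\<close>: the evaluation step coded by \<open>v\<close> follows by one rule of \<open>ev\<close> from steps in
  \<open>M\<close>, where \<open>R\<close> is the graph of the (possibly partial) oracle.\<close>

definition justified :: "(nat \<Rightarrow> nat \<Rightarrow> bool) \<Rightarrow> nat set \<Rightarrow> nat \<Rightarrow> bool" where
  "justified R M v \<longleftrightarrow>
    (let e = pfst v; x = pfst (psnd v); y = psnd (psnd v); f = pfst (psnd e); g = psnd (psnd e) in
      e = \<langle>0, 0\<rangle> \<and> y = 0 \<or>
      e = \<langle>1, 0\<rangle> \<and> y = Suc x \<or>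
      e = \<langle>2, 0\<rangle> \<and> y = x \<or>
      e = \<langle>3, 0\<rangle> \<and> R x y \<or>
      e = \<langle>4, 0\<rangle> \<and> y = pfst x \<or>
      e = \<langle>5, 0\<rangle> \<and> y = psnd x \<or>
      pfst e = 6 \<and> step_code f x (pfst y) \<in> M \<and> step_code g x (psnd y) \<in> M \<or>
      pfst e = 7 \<and> (\<exists>w\<in>M. pfst w = g \<and> pfst (psnd w) = x \<and> step_code f (psnd (psnd w)) y \<in> M) \<or>
      pfst e = 8 \<and> psnd x = 0 \<and> step_code f (pfst x) y \<in> M \<or>
      pfst e = 8 \<and> psnd x \<noteq> 0 \<and>
        (\<exists>w\<in>M. pfst w = e \<and> pfst (psnd w) = \<langle>pfst x, psnd x - 1\<rangle> \<and>
               step_code g \<langle>pfst x, \<langle>psnd x - 1, psnd (psnd w)\<rangle>\<rangle> y \<in> M) \<or>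
      pfst e = 9 \<and> step_code (psnd e) \<langle>x, y\<rangle> 0 \<in> M \<and>
        (\<forall>m<y. \<exists>w\<in>M. pfst w = psnd e \<and> pfst (psnd w) = \<langle>x, m\<rangle> \<and> psnd (psnd w) \<noteq> 0))"

lemma justified_mono:
  assumes "justified R M v" "\<And>x y. R x y \<Longrightarrow> R' x y" "M \<subseteq> M'"
  shows "justified R' M' v"
  using assms(1) unfolding justified_def Let_def
  by (elim disj_forward conj_forward)
     (assumption | erule assms(2) | erule subsetD[OF assms(3)] | (use assms(3) in blast))+

lemma justified_sound:
  assumes "justified R M (step_code (enc p) x y)" "\<And>x y. R x y \<Longrightarrow> y = A x"
    and M: "\<And>q x y. step_code (enc q) x y \<in> M \<Longrightarrow> ev A q x y"
  shows "ev A p x y"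
proof (cases p)
  case (Pair_p f g)
  then show ?thesis using assms(1) M ev_Pair[of A f x "pfst y" g "psnd y"]
    by (auto simp: justified_def)
next
  case (Comp_p f g)
  then obtain w where "w \<in> M" "pfst w = enc g" "pfst (psnd w) = x" "step_code (enc f) (psnd (psnd w)) y \<in> M"
    using assms(1) by (auto simp: justified_def)
  then have "ev A g x (psnd (psnd w))" "ev A f (psnd (psnd w)) y"
    using M by (metis pair_code_collapse)+
  then show ?thesis using Comp_p by (simp add: ev_Comp)
next
  case (Rec_p f g)
  show ?thesis
  proof (cases "psnd x")
    case 0
    then show ?thesis using Rec_p assms(1) M ev_Rec0[of A f "pfst x" y g]
      by (auto simp: justified_def) (metis pair_code_collapse)
  next
    case (Suc n)
    then obtain w where "w \<in> M" "pfst w = enc (Rec_p f g)" "pfst (psnd w) = \<langle>pfst x, n\<rangle>"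
      "step_code (enc g) \<langle>pfst x, \<langle>n, psnd (psnd w)\<rangle>\<rangle> y \<in> M"
      using assms(1) Rec_p by (auto simp: justified_def)
    then have "ev A (Rec_p f g) \<langle>pfst x, n\<rangle> (psnd (psnd w))" "ev A g \<langle>pfst x, \<langle>n, psnd (psnd w)\<rangle>\<rangle> y"
      using M by (metis pair_code_collapse)+
    then have "ev A (Rec_p f g) \<langle>pfst x, Suc n\<rangle> y" by (rule ev_RecS)
    then show ?thesis using Rec_p Suc by (metis pair_code_collapse)
  qed
next
  case (Mu_p f)
  have 0: "step_code (enc f) \<langle>x, y\<rangle> 0 \<in> M" and
    w: "\<And>m. m < y \<Longrightarrow> \<exists>w\<in>M. pfst w = enc f \<and> pfst (psnd w) = \<langle>x, m\<rangle> \<and> psnd (psnd w) \<noteq> 0"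
    using assms(1) Mu_p by (auto simp: justified_def)
  have "\<exists>z. ev A f \<langle>x, m\<rangle> (Suc z)" if "m < y" for m
    using w[OF that] M by (metis not0_implies_Suc pair_code_collapse)
  then show ?thesis using Mu_p M[OF 0] by (simp add: ev_Mu)
qed (use assms(1,2) in \<open>auto simp: justified_def intro: ev.intros\<close>)

text \<open>A derivation is finite and consults finitely many oracle values. Cutting the oracle off
  at \<open>t\<close> lets everything it needs be coded by \<open>restr A t\<close>.\<close>

definition oracle_upto :: "(nat \<Rightarrow> nat) \<Rightarrow> nat \<Rightarrow> nat \<Rightarrow> nat \<Rightarrow> bool" where
  "oracle_upto A t x y \<longleftrightarrow> x < t \<and> y = A x"

definition valid_deriv :: "(nat \<Rightarrow> nat \<Rightarrow> bool) \<Rightarrow> nat list \<Rightarrow> bool" where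
  "valid_deriv R L \<longleftrightarrow> (\<forall>j<length L. justified R (set (take j L)) (L ! j))"

definition derivable :: "(nat \<Rightarrow> nat) \<Rightarrow> nat \<Rightarrow> bool" where
  "derivable A v \<longleftrightarrow> (\<exists>L t. valid_deriv (oracle_upto A t) L \<and> v \<in> set L)"

lemma valid_deriv_mono: "valid_deriv (oracle_upto A s) L \<Longrightarrow> s \<le> t \<Longrightarrow> valid_deriv (oracle_upto A t) L"
  unfolding valid_deriv_def oracle_upto_def by (auto elim!: justified_mono)

lemma valid_deriv_append:
  assumes "valid_deriv R L" "valid_deriv R L'" shows "valid_deriv R (L @ L')"
  unfolding valid_deriv_def
proof (intro allI impI)
  fix j assume j: "j < length (L @ L')"
  show "justified R (set (take j (L @ L'))) ((L @ L') ! j)"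
  proof (cases "j < length L")
    case True
    then show ?thesis using assms(1) by (simp add: valid_deriv_def nth_append)
  next
    case False
    then have "justified R (set (take (j - length L) L')) (L' ! (j - length L))"
      using assms(2) j by (simp add: valid_deriv_def)
    then show ?thesis using False by (auto simp: nth_append elim!: justified_mono)
  qed
qed

lemma derivable_finite:
  assumes "finite V" "\<And>v. v \<in> V \<Longrightarrow> derivable A v"
  shows "\<exists>L t. valid_deriv (oracle_upto A t) L \<and> V \<subseteq> set L"
  using assms
proof (induction V rule: finite_induct)
  case empty
  show ?case by (intro exI[of _ "[]"]) (simp add: valid_deriv_def)
next
  case (insert v V)
  then obtain L t where L: "valid_deriv (oracle_upto A t) L" "V \<subseteq> set L" by blast
  obtain L' t' where L': "valid_deriv (oracle_upto A t') L'" "v \<in> set L'"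
    using insert.prems unfolding derivable_def by blast
  have "valid_deriv (oracle_upto A (max t t')) (L @ L')"
    using L(1) L'(1) by (intro valid_deriv_append) (auto elim!: valid_deriv_mono)
  then show ?case using L(2) L'(2) by (intro exI[of _ "L @ L'"] exI[of _ "max t t'"]) auto
qed

text \<open>Derivations of the premises are concatenated at a common oracle bound and the conclusion
  is appended. Allowing any finite \<open>V\<close> covers minimization, which has one premise for
  each candidate tested.\<close>

lemma derivable_step:
  assumes "finite V" "\<And>v. v \<in> V \<Longrightarrow> derivable A v" "justified (oracle_upto A s) V v"
  shows "derivable A v"
proof -
  obtain L t where L: "valid_deriv (oracle_upto A t) L" "V \<subseteq> set L"
    using derivable_finite[OF assms(1,2)] by blast
  have "valid_deriv (oracle_upto A (max s t)) L"
    using L(1) by (rule valid_deriv_mono) simp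
  moreover have "justified (oracle_upto A (max s t)) (set L) v"
    using L(2) by (intro justified_mono[OF assms(3)]) (auto simp: oracle_upto_def)
  ultimately have "valid_deriv (oracle_upto A (max s t)) (L @ [v])"
    by (auto simp: valid_deriv_def nth_append less_Suc_eq)
  then show ?thesis unfolding derivable_def by (intro exI[of _ "L @ [v]"] exI[of _ "max s t"]) auto
qed

lemma ev_derivable: "ev A p x y \<Longrightarrow> derivable A (step_code (enc p) x y)"
proof (induction rule: ev.induct)
  case (ev_Zer x)
  show ?case by (rule derivable_step[of "{}" _ 0]) (auto simp: justified_def)
next
  case (ev_Suc x)
  show ?case by (rule derivable_step[of "{}" _ 0]) (auto simp: justified_def)
next
  case (ev_Id x)
  show ?case by (rule derivable_step[of "{}" _ 0]) (auto simp: justified_def)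
next
  case (ev_Orc x)
  show ?case by (rule derivable_step[of "{}" _ "Suc x"]) (auto simp: justified_def oracle_upto_def)
next
  case (ev_Fst x)
  show ?case by (rule derivable_step[of "{}" _ 0]) (auto simp: justified_def)
next
  case (ev_Snd x)
  show ?case by (rule derivable_step[of "{}" _ 0]) (auto simp: justified_def)
next
  case (ev_Pair f x y g z)
  show ?case
    by (rule derivable_step[of "{step_code (enc f) x y, step_code (enc g) x z}" _ 0])
       (use ev_Pair.IH in \<open>auto simp: justified_def\<close>)
next
  case (ev_Comp g x y f z)
  show ?case
    by (rule derivable_step[of "{step_code (enc g) x y, step_code (enc f) y z}" _ 0])
       (use ev_Comp.IH in \<open>auto simp: justified_def\<close>)
next
  case (ev_Rec0 f x y g)
  show ?case
    by (rule derivable_step[of "{step_code (enc f) x y}" _ 0])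
       (use ev_Rec0.IH in \<open>auto simp: justified_def\<close>)
next
  case (ev_RecS f g x n y z)
  show ?case
    by (rule derivable_step[of "{step_code (enc (Rec_p f g)) \<langle>x, n\<rangle> y, step_code (enc g) \<langle>x, \<langle>n, y\<rangle>\<rangle> z}" _ 0])
       (use ev_RecS.IH in \<open>auto simp: justified_def\<close>)
next
  case (ev_Mu f x n)
  then obtain y where y: "\<And>m. m < n \<Longrightarrow> derivable A (step_code (enc f) \<langle>x, m\<rangle> (Suc (y m)))"
    by metis
  show ?case
    by (rule derivable_step[of "insert (step_code (enc f) \<langle>x, n\<rangle> 0) ((\<lambda>m. step_code (enc f) \<langle>x, m\<rangle> (Suc (y m))) ` {..<n})" _ 0])
       (use y ev_Mu.IH in \<open>auto simp: justified_def\<close>)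
qed

lemma derivable_ev:
  assumes "derivable A (step_code (enc p) x y)" shows "ev A p x y"
proof -
  obtain L t where L: "valid_deriv (oracle_upto A t) L" "step_code (enc p) x y \<in> set L"
    using assms unfolding derivable_def by blast
  have "j < length L \<Longrightarrow> L ! j = step_code (enc p) x y \<Longrightarrow> ev A p x y" for j p x y
  proof (induction j arbitrary: p x y rule: less_induct)
    case (less j)
    have 1: "justified (oracle_upto A t) (set (take j L)) (step_code (enc p) x y)"
      using L(1) less.prems unfolding valid_deriv_def by metis
    have 2: "ev A q u v" if "step_code (enc q) u v \<in> set (take j L)" for q u v
      using that less by (auto simp: in_set_conv_nth)
    show ?case
      by (rule justified_sound[OF 1 _ 2]) (auto simp: oracle_upto_def)
  qed
  then show ?thesis using L(2) by (metis in_set_conv_nth)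
qed

text \<open>\<open>deriv_code s d v\<close>: \<open>d\<close> codes a derivation of \<open>v\<close> from the finite part of the oracle coded by
  \<open>s\<close>. This is Kleene's T predicate.\<close>

definition deriv_code :: "nat \<Rightarrow> nat \<Rightarrow> nat \<Rightarrow> bool" where
  "deriv_code s d v \<longleftrightarrow>
     (\<forall>j<lenc d. justified (\<lambda>x y. x < lenc s \<and> y = nthc s x) (nthc d ` {..<j}) (nthc d j)) \<and>
     (\<exists>j<lenc d. nthc d j = v)"

lemma deriv_code_restr:
  "deriv_code (restr A t) d v \<longleftrightarrow> valid_deriv (oracle_upto A t) (list_decode d) \<and> v \<in> set (list_decode d)"
proof -
  have "(\<lambda>x y. x < lenc (restr A t) \<and> y = nthc (restr A t) x) = oracle_upto A t"
    by (auto simp: oracle_upto_def fun_eq_iff)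
  moreover have "nthc d ` {..<j} = set (take j (list_decode d))" if "j < lenc d" for j
    using that by (auto simp: lenc_def nthc_nth nth_image[symmetric])
  moreover have "(\<exists>j<lenc d. nthc d j = v) \<longleftrightarrow> v \<in> set (list_decode d)"
    using nthc_nth by (auto simp: in_set_conv_nth lenc_def)
  ultimately show ?thesis
    unfolding deriv_code_def valid_deriv_def by (auto simp: nthc_nth lenc_def)
qed

lemma deriv_code_mono: "deriv_code (restr A s) d v \<Longrightarrow> s \<le> t \<Longrightarrow> deriv_code (restr A t) d v"
  unfolding deriv_code_restr using valid_deriv_mono by blast

theorem ev_iff_deriv_code: "ev A p x y \<longleftrightarrow> (\<exists>t d. deriv_code (restr A t) d (step_code (enc p) x y))"
  unfolding deriv_code_restr
  by (metis derivable_def derivable_ev ev_derivable list_encode_inverse)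

lemma recp_deriv_code [rec_intros]:
  assumes "recf \<O> S" "recf \<O> D" "recf \<O> V"
  shows "recp \<O> (\<lambda>f x. deriv_code (S f x) (D f x) (V f x))"
proof -
  \<comment> \<open>Quantifiers over images of initial segments become bounded number quantifiers,
    which \<open>rec_intros\<close> can handle.\<close>
  have mem: "v \<in> F ` {..<j} \<longleftrightarrow> (\<exists>i<j. F i = v)" and
    bex: "(\<exists>w\<in>F ` {..<j}. P w) \<longleftrightarrow> (\<exists>i<j. P (F i))" for F :: "nat \<Rightarrow> nat" and v j P by auto
  have "recp \<O> (\<lambda>f z. deriv_code (pfst z) (pfst (psnd z)) (psnd (psnd z)))"
    unfolding deriv_code_def justified_def Let_def mem bex by (intro rec_intros)
  from recp_comp[OF this, of "\<lambda>f x. \<langle>S f x, \<langle>D f x, V f x\<rangle>\<rangle>"] show ?thesis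
    using assms by (simp add: rec_intros)
qed

section \<open>Semidecidable, $\Pi^1_1$ and arithmetical relations\<close>

definition semi :: "((nat \<Rightarrow> nat) \<Rightarrow> nat \<Rightarrow> bool) \<Rightarrow> bool" where
  "semi Q \<longleftrightarrow> (\<exists>M. recp UNIV M \<and> (\<forall>f x. Q f x \<longleftrightarrow> (\<exists>t. M f \<langle>x, t\<rangle>)))"

text \<open>The matrix in \<open>semi\<close> may consult the oracle anywhere; here it becomes a
  decidable property of finite sequences. This permits substituting functionals for oracles, and it
  makes the counterexamples to a \<open>Pi11\<close> statement the paths of a tree.\<close>

lemma semi_normal_form:
  assumes "semi Q"
  obtains D where "\<forall>\<O>. recp \<O> (\<lambda>f z. D (pfst z) (psnd z))"
    "\<And>f x. Q f x \<longleftrightarrow> (\<exists>t. D (restr f t) x)"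
proof -
  obtain M where M: "recp UNIV M" and Q: "\<And>f x. Q f x \<longleftrightarrow> (\<exists>t. M f \<langle>x, t\<rangle>)"
    using assms unfolding semi_def by blast
  obtain p where p: "\<And>f x. ev f p x (of_bool (M f x))"
    using M unfolding recp_def recf_def by blast
  have M_ev: "M f x \<longleftrightarrow> ev f p x 1" for f x
    using p[of f x] ev_deterministic[OF p[of f x], of 1] by (cases "M f x") auto
  \<comment> \<open>Tying the search bounds to \<open>lenc s\<close> keeps \<open>D\<close>
    decidable; any witness is found once the segment is long enough.\<close>
  define D where "D s x \<longleftrightarrow> (\<exists>t<lenc s. \<exists>d<lenc s. deriv_code s d (step_code (enc p) \<langle>x, t\<rangle> 1))" for s x
  show thesis
  proof
    show "\<forall>\<O>. recp \<O> (\<lambda>f z. D (pfst z) (psnd z))"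
      unfolding D_def by (intro allI rec_intros)
    show "Q f x \<longleftrightarrow> (\<exists>t. D (restr f t) x)" for f x
    proof
      assume "Q f x"
      then obtain t s d where "deriv_code (restr f s) d (step_code (enc p) \<langle>x, t\<rangle> 1)"
        unfolding Q M_ev ev_iff_deriv_code by blast
      then have "deriv_code (restr f (s + t + d + 1)) d (step_code (enc p) \<langle>x, t\<rangle> 1)"
        by (rule deriv_code_mono) simp
      then have "D (restr f (s + t + d + 1)) x"
        unfolding D_def by (intro exI[of _ t] exI[of _ d] conjI) auto
      then show "\<exists>t. D (restr f t) x" ..
    next
      assume "\<exists>t. D (restr f t) x"
      then show "Q f x" unfolding D_def Q M_ev ev_iff_deriv_code by blast
    qed
  qed
qed

lemma semi_recp:
  assumes "recp UNIV P" shows "semi P"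
proof -
  have "recp UNIV (\<lambda>f z. P f (pfst z))" by (intro recp_comp[OF assms] rec_intros)
  then show ?thesis unfolding semi_def by (intro exI[of _ "\<lambda>f z. P f (pfst z)"]) simp
qed

text \<open>Substituting a computable functional for the oracle needs no program transformation: by the
  normal form only the finite sequence \<open>restr (H f x) t\<close> is ever consulted.\<close>

lemma recf_subst:
  assumes "recf UNIV F" "recf \<O> (\<lambda>f z. H f (pfst z) (psnd z))" "recf \<O> N"
  shows "recf \<O> (\<lambda>f x. F (H f x) (N f x))"
proof -
  have "semi (\<lambda>f z. F f (pfst z) = psnd z)"
    by (intro semi_recp rec_intros recf_comp[OF assms(1)])
  then obtain D where D: "\<forall>\<O>. recp \<O> (\<lambda>f z. D (pfst z) (psnd z))"
    and F: "\<And>f z. F f (pfst z) = psnd z \<longleftrightarrow> (\<exists>t. D (restr f t) z)"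
    by (rule semi_normal_form) (rule that)
  \<comment> \<open>\<open>k\<close> pairs a candidate output with the length of a segment
    certifying it. Every such \<open>k\<close> carries the right output, so the least one may be
    used.\<close>
  define P where "P f x k \<longleftrightarrow> D (restr (H f x) (psnd k)) \<langle>N f x, pfst k\<rangle>" for f x k
  have H: "recf \<O> (\<lambda>f z. H f (A f z) (B f z))" if "recf \<O> A" "recf \<O> B" for A B
    using recf_comp[OF assms(2), of "\<lambda>f z. \<langle>A f z, B f z\<rangle>"] that by (simp add: rec_intros)
  have "recf \<O> (\<lambda>f z. \<langle>restr (H f (pfst z)) (psnd (psnd z)), \<langle>N f (pfst z), pfst (psnd z)\<rangle>\<rangle>)"
    by (intro rec_intros H recf_comp[OF assms(3)])
  from recp_comp[OF spec[OF D] this] have recP: "recp \<O> (\<lambda>f z. P f (pfst z) (psnd z))"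
    by (simp add: P_def)
  have exP: "\<exists>k. P f x k" for f x
  proof -
    obtain t where "D (restr (H f x) t) \<langle>N f x, F (H f x) (N f x)\<rangle>"
      using F[of "H f x" "\<langle>N f x, F (H f x) (N f x)\<rangle>"] by auto
    then show ?thesis unfolding P_def by (intro exI[of _ "\<langle>F (H f x) (N f x), t\<rangle>"]) simp
  qed
  have "F (H f x) (N f x) = pfst k" if "P f x k" for f x k
    using F[of "H f x" "\<langle>N f x, pfst k\<rangle>"] that unfolding P_def by auto
  from this[OF LeastI_ex[OF exP]] have "F (H f x) (N f x) = pfst (LEAST k. P f x k)" for f x .
  then show ?thesis using recf_fst[OF recf_Least[OF recP exP]] by simp
qed

lemma recp_subst:
  assumes "recp UNIV P" "recf \<O> (\<lambda>f z. H f (pfst z) (psnd z))" "recf \<O> N"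
  shows "recp \<O> (\<lambda>f x. P (H f x) (N f x))"
  using recf_subst[of "\<lambda>f x. of_bool (P f x)"] assms unfolding recp_def .

lemma semi_subst:
  assumes "semi Q" "recf UNIV (\<lambda>f z. H f (pfst z) (psnd z))" "recf UNIV N"
  shows "semi (\<lambda>f x. Q (H f x) (N f x))"
proof -
  obtain M where M: "recp UNIV M" and Q: "\<And>f x. Q f x \<longleftrightarrow> (\<exists>t. M f \<langle>x, t\<rangle>)"
    using assms(1) unfolding semi_def by blast
  have H: "recf UNIV (\<lambda>f z. H f (A f z) (B f z))" if "recf UNIV A" "recf UNIV B" for A B
    using recf_comp[OF assms(2), of "\<lambda>f z. \<langle>A f z, B f z\<rangle>"] that by (simp add: rec_intros)
  have "recp UNIV (\<lambda>f z. M (H f (pfst z)) \<langle>N f (pfst z), psnd z\<rangle>)"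
    by (rule recp_subst[OF M]) (intro rec_intros H recf_comp[OF assms(3)])+
  then show ?thesis
    unfolding semi_def Q by (intro exI[of _ "\<lambda>f z. M (H f (pfst z)) \<langle>N f (pfst z), psnd z\<rangle>"]) auto
qed

lemma semi_conj:
  assumes "semi P" "semi Q" shows "semi (\<lambda>f x. P f x \<and> Q f x)"
proof -
  obtain M N where M: "recp UNIV M" "\<And>f x. P f x \<longleftrightarrow> (\<exists>t. M f \<langle>x, t\<rangle>)"
    and N: "recp UNIV N" "\<And>f x. Q f x \<longleftrightarrow> (\<exists>t. N f \<langle>x, t\<rangle>)"
    using assms unfolding semi_def by blast
  let ?K = "\<lambda>f z. M f \<langle>pfst z, pfst (psnd z)\<rangle> \<and> N f \<langle>pfst z, psnd (psnd z)\<rangle>"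
  have "recp UNIV ?K" by (intro rec_intros recp_comp[OF M(1)] recp_comp[OF N(1)])
  moreover have "P f x \<and> Q f x \<longleftrightarrow> (\<exists>t. ?K f \<langle>x, t\<rangle>)" for f x
    unfolding M N by (metis fst_conv prod_encode_inverse snd_conv)
  ultimately show ?thesis unfolding semi_def by blast
qed

lemma semi_disj:
  assumes "semi P" "semi Q" shows "semi (\<lambda>f x. P f x \<or> Q f x)"
proof -
  obtain M N where M: "recp UNIV M" "\<And>f x. P f x \<longleftrightarrow> (\<exists>t. M f \<langle>x, t\<rangle>)"
    and N: "recp UNIV N" "\<And>f x. Q f x \<longleftrightarrow> (\<exists>t. N f \<langle>x, t\<rangle>)"
    using assms unfolding semi_def by blast
  have "recp UNIV (\<lambda>f z. M f z \<or> N f z)" by (intro rec_intros M(1) N(1))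
  then show ?thesis unfolding semi_def M N
    by (intro exI[of _ "\<lambda>f z. M f z \<or> N f z"]) auto
qed

lemma semi_ex:
  assumes "semi (\<lambda>f z. Q f (pfst z) (psnd z))" shows "semi (\<lambda>f x. \<exists>n. Q f x n)"
proof -
  obtain M where M: "recp UNIV M" and Q: "\<And>f z. Q f (pfst z) (psnd z) \<longleftrightarrow> (\<exists>t. M f \<langle>z, t\<rangle>)"
    using assms unfolding semi_def by blast
  let ?K = "\<lambda>f z. M f \<langle>\<langle>pfst z, pfst (psnd z)\<rangle>, psnd (psnd z)\<rangle>"
  have "recp UNIV ?K" by (intro rec_intros recp_comp[OF M])
  moreover have "(\<exists>n. Q f x n) \<longleftrightarrow> (\<exists>t. ?K f \<langle>x, t\<rangle>)" for f x
    using Q[of f "\<langle>x, _\<rangle>"] by (metis fst_conv prod_encode_inverse snd_conv)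
  ultimately show ?thesis unfolding semi_def by blast
qed

text \<open>Post's theorem: a parallel search for a witness of \<open>P\<close> or of its negation
  always ends, and the witness found tells which side holds.\<close>

lemma recp_if_semi_semi_not:
  assumes "semi P" "semi (\<lambda>f x. \<not> P f x)" shows "recp UNIV P"
proof -
  obtain M N where M: "recp UNIV M" "\<And>f x. P f x \<longleftrightarrow> (\<exists>t. M f \<langle>x, t\<rangle>)"
    and N: "recp UNIV N" "\<And>f x. \<not> P f x \<longleftrightarrow> (\<exists>t. N f \<langle>x, t\<rangle>)"
    using assms unfolding semi_def by blast
  have ex: "\<exists>t. M f \<langle>x, t\<rangle> \<or> N f \<langle>x, t\<rangle>" for f x using M(2) N(2) by blast
  have "recf UNIV (\<lambda>f x. LEAST t. M f \<langle>x, t\<rangle> \<or> N f \<langle>x, t\<rangle>)"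
    by (rule recf_Least) (simp_all add: rec_intros M(1) N(1) ex)
  then have "recp UNIV (\<lambda>f x. M f \<langle>x, LEAST t. M f \<langle>x, t\<rangle> \<or> N f \<langle>x, t\<rangle>\<rangle>)"
    by (intro recp_comp[OF M(1)] rec_intros)
  moreover have "M f \<langle>x, LEAST t. M f \<langle>x, t\<rangle> \<or> N f \<langle>x, t\<rangle>\<rangle> \<longleftrightarrow> P f x" for f x
    using LeastI_ex[OF ex[of f x]] M(2) N(2) by blast
  ultimately show ?thesis by simp
qed

lemma semi_ev:
  assumes "recf UNIV (\<lambda>f z. H f (pfst z) (psnd z))" "recf UNIV E" "recf UNIV X" "recf UNIV Y"
  shows "semi (\<lambda>f z. ev (H f z) (program (E f z)) (X f z) (Y f z))"
proof -
  let ?U = "\<lambda>f z. ev f (program (pfst z)) (pfst (psnd z)) (psnd (psnd z))"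
  \<comment> \<open>The first disjunct accounts for the default program \<open>Zer\<close> at
    numbers that are not codes.\<close>
  let ?M = "\<lambda>f w. pfst (pfst w) \<notin> range enc \<and> psnd (psnd (pfst w)) = 0 \<or>
     pfst (pfst w) \<in> range enc \<and> deriv_code (restr f (pfst (psnd w))) (psnd (psnd w)) (pfst w)"
  have "recp UNIV ?M" by (intro rec_intros)
  moreover have "?U f z \<longleftrightarrow> (\<exists>t. ?M f \<langle>z, t\<rangle>)" for f z
  proof (cases "pfst z \<in> range enc")
    case True
    then obtain p where p: "pfst z = enc p" by blast
    then have "z = step_code (enc p) (pfst (psnd z)) (psnd (psnd z))" by (metis pair_code_collapse)
    then have "?U f z \<longleftrightarrow> (\<exists>t d. deriv_code (restr f t) d z)"
      using p by (simp add: ev_iff_deriv_code)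
    also have "\<dots> \<longleftrightarrow> (\<exists>k. deriv_code (restr f (pfst k)) (psnd k) z)"
      by (metis fst_conv prod_encode_inverse snd_conv)
    finally show ?thesis using True by simp
  next
    case False
    then show ?thesis by (auto simp: program_def intro: ev_Zer elim: ev_ZerE)
  qed
  ultimately have "semi ?U" unfolding semi_def by blast
  from semi_subst[OF this assms(1), of "\<lambda>f z. step_code (E f z) (X f z) (Y f z)"]
  show ?thesis using assms by (simp add: rec_intros)
qed

lemma semi_program:
  assumes "semi Q" obtains p where "\<And>f x. Q f x \<longleftrightarrow> (\<exists>y. ev f p x y)"
proof -
  obtain M where M: "recp UNIV M" and Q: "\<And>f x. Q f x \<longleftrightarrow> (\<exists>t. M f \<langle>x, t\<rangle>)"
    using assms unfolding semi_def by blast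
  have "recp UNIV (\<lambda>f x. \<not> M f x)" by (intro rec_intros M)
  then obtain p where p: "\<And>f x. ev f p x (of_bool (\<not> M f x))"
    unfolding recp_def recf_def by blast
  have "Q f x \<longleftrightarrow> (\<exists>y. ev f (Mu_p p) x y)" for f x
  proof
    assume "Q f x"
    then show "\<exists>y. ev f (Mu_p p) x y" unfolding Q using ev_Mu_Least[OF p] by blast
  next
    assume "\<exists>y. ev f (Mu_p p) x y"
    then obtain y where "ev f p \<langle>x, y\<rangle> 0" by (auto elim: ev_MuE)
    then have "M f \<langle>x, y\<rangle>" using ev_deterministic[OF p] by fastforce
    then show "Q f x" unfolding Q ..
  qed
  then show thesis by (rule that)
qed

section \<open>Relations with one universal function quantifier\<close>

definition join :: "(nat \<Rightarrow> nat) \<Rightarrow> (nat \<Rightarrow> nat) \<Rightarrow> nat \<Rightarrow> nat" where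
  "join f g k = (if pfst k = 0 then f (psnd k) else g (psnd k))"
definition left :: "(nat \<Rightarrow> nat) \<Rightarrow> nat \<Rightarrow> nat" where "left h n = h \<langle>0, n\<rangle>"
definition right :: "(nat \<Rightarrow> nat) \<Rightarrow> nat \<Rightarrow> nat" where "right h n = h \<langle>1, n\<rangle>"

lemma left_join [simp]: "left (join f g) = f"
  by (simp add: fun_eq_iff left_def join_def)

lemma right_join [simp]: "right (join f g) = g"
  by (simp add: fun_eq_iff right_def join_def)

lemma recf_join [rec_intros]:
  assumes "recf \<O> (\<lambda>f z. F f (pfst z) (psnd z))" "recf \<O> (\<lambda>f z. G f (pfst z) (psnd z))" "recf \<O> N"
  shows "recf \<O> (\<lambda>f x. join (F f x) (G f x) (N f x))"
proof -
  have "recf \<O> (\<lambda>f x. F f x (psnd (N f x)))" "recf \<O> (\<lambda>f x. G f x (psnd (N f x)))"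
    using recf_comp[OF assms(1), of "\<lambda>f x. \<langle>x, psnd (N f x)\<rangle>"]
      recf_comp[OF assms(2), of "\<lambda>f x. \<langle>x, psnd (N f x)\<rangle>"] assms(3) by (simp_all add: rec_intros)
  then show ?thesis unfolding join_def by (intro rec_intros assms(3))
qed

lemma recf_left [rec_intros]: "recf \<O> N \<Longrightarrow> recf \<O> (\<lambda>f x. left f (N f x))"
  unfolding left_def by (intro rec_intros)

lemma recf_right [rec_intros]: "recf \<O> N \<Longrightarrow> recf \<O> (\<lambda>f x. right f (N f x))"
  unfolding right_def by (intro rec_intros)

text \<open>The universally quantified function is joined to a free one. Keeping a free function
  variable lets closure properties be combined before it is quantified as well.\<close>

definition pi11 :: "((nat \<Rightarrow> nat) \<Rightarrow> nat \<Rightarrow> bool) \<Rightarrow> bool" where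
  "pi11 P \<longleftrightarrow> (\<exists>Q. semi Q \<and> (\<forall>f x. P f x \<longleftrightarrow> (\<forall>g. Q (join f g) x)))"

lemma pi11_semi: "semi P \<Longrightarrow> pi11 P"
  unfolding pi11_def using semi_subst[of P "\<lambda>h x. left h" "\<lambda>h x. x"]
  by (intro exI[of _ "\<lambda>h x. P (left h) x"]) (simp add: rec_intros)

lemma pi11_conj:
  assumes "pi11 P" "pi11 P'" shows "pi11 (\<lambda>f x. P f x \<and> P' f x)"
proof -
  obtain Q Q' where "semi Q" "\<And>f x. P f x \<longleftrightarrow> (\<forall>g. Q (join f g) x)"
    "semi Q'" "\<And>f x. P' f x \<longleftrightarrow> (\<forall>g. Q' (join f g) x)"
    using assms unfolding pi11_def by blast
  then show ?thesis
    unfolding pi11_def by (intro exI[of _ "\<lambda>f x. Q f x \<and> Q' f x"]) (auto intro: semi_conj)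
qed

lemma pi11_disj:
  assumes "pi11 P" "pi11 P'" shows "pi11 (\<lambda>f x. P f x \<or> P' f x)"
proof -
  obtain Q Q' where Q: "semi Q" "\<And>f x. P f x \<longleftrightarrow> (\<forall>g. Q (join f g) x)"
    and Q': "semi Q'" "\<And>f x. P' f x \<longleftrightarrow> (\<forall>g. Q' (join f g) x)"
    using assms unfolding pi11_def by blast
  \<comment> \<open>The two universal quantifiers are independent, so each disjunct gets its own
    half of the quantified function.\<close>
  let ?K = "\<lambda>h x. Q (join (left h) (left (right h))) x \<or> Q' (join (left h) (right (right h))) x"
  have "recf UNIV (\<lambda>h z. left (right h) (psnd z))" "recf UNIV (\<lambda>h z. right (right h) (psnd z))"
    unfolding left_def right_def by (intro rec_intros)+
  then have "semi ?K"
    by (intro semi_disj semi_subst[OF Q(1)] semi_subst[OF Q'(1)] rec_intros)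
  moreover have "P f x \<or> P' f x \<longleftrightarrow> (\<forall>g. ?K (join f g) x)" for f x
    unfolding Q Q' by (metis left_join right_join)
  ultimately show ?thesis unfolding pi11_def by blast
qed

lemma pi11_all:
  assumes "pi11 (\<lambda>f z. P f (pfst z) (psnd z))" shows "pi11 (\<lambda>f x. \<forall>n. P f x n)"
proof -
  obtain Q where Q: "semi Q" and P: "\<And>f z. P f (pfst z) (psnd z) \<longleftrightarrow> (\<forall>g. Q (join f g) z)"
    using assms unfolding pi11_def by blast
  \<comment> \<open>The number \<open>n\<close> is stored at argument 0 of the quantified function,
    and the old function is shifted by one.\<close>
  let ?K = "\<lambda>h x. Q (join (left h) (\<lambda>k. right h (Suc k))) \<langle>x, right h 0\<rangle>"
  have "semi ?K" by (intro semi_subst[OF Q] rec_intros)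
  moreover have "(\<forall>n. P f x n) \<longleftrightarrow> (\<forall>g. ?K (join f g) x)" for f x
  proof
    assume "\<forall>n. P f x n"
    then show "\<forall>g. ?K (join f g) x" using P[of f "\<langle>x, _\<rangle>"] by simp
  next
    assume K: "\<forall>g. ?K (join f g) x"
    have "Q (join f g) \<langle>x, n\<rangle>" for n g
      using K[rule_format, of "case_nat n g"] by simp
    then show "\<forall>n. P f x n" using P[of f "\<langle>x, _\<rangle>"] by simp
  qed
  ultimately show ?thesis unfolding pi11_def by blast
qed

lemma pi11_ex:
  assumes "pi11 (\<lambda>f z. P f (pfst z) (psnd z))" shows "pi11 (\<lambda>f x. \<exists>n. P f x n)"
proof -
  obtain Q where Q: "semi Q" and P: "\<And>f z. P f (pfst z) (psnd z) \<longleftrightarrow> (\<forall>g. Q (join f g) z)"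
    using assms unfolding pi11_def by blast
  \<comment> \<open>Column \<open>n\<close> of a single function serves as the function for
    \<open>n\<close>: if every \<open>n\<close> failed, chosen counterexamples would fill the
    columns.\<close>
  let ?K = "\<lambda>h x. \<exists>n. Q (join (left h) (\<lambda>k. right h \<langle>n, k\<rangle>)) \<langle>x, n\<rangle>"
  have "semi ?K" by (intro semi_ex semi_subst[OF Q] rec_intros)
  moreover have "(\<exists>n. P f x n) \<longleftrightarrow> (\<forall>g. ?K (join f g) x)" for f x
  proof
    assume "\<exists>n. P f x n"
    then show "\<forall>g. ?K (join f g) x" using P[of f "\<langle>x, _\<rangle>"] by auto
  next
    assume K: "\<forall>g. ?K (join f g) x"
    show "\<exists>n. P f x n"
    proof (rule ccontr)
      assume "\<nexists>n. P f x n"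
      then have "\<forall>n. \<exists>g. \<not> Q (join f g) \<langle>x, n\<rangle>" using P[of f "\<langle>x, _\<rangle>"] by simp
      then obtain g where "\<And>n. \<not> Q (join f (g n)) \<langle>x, n\<rangle>" by metis
      then show False using K[rule_format, of "\<lambda>k. g (pfst k) (psnd k)"] by simp
    qed
  qed
  ultimately show ?thesis unfolding pi11_def by blast
qed

text \<open>Two function quantifiers are contracted to one. The last clause keeps track of which
  part of a counterexample \<open>h\<close> violates \<open>P\<close>; the diagonalization reads its
  data from there.\<close>

lemma pi11_forall_oracle:
  assumes "pi11 P"
  obtains Q where "semi Q" "\<And>x. (\<forall>f. P f x) \<longleftrightarrow> (\<forall>h. Q h x)" "\<And>h x. \<not> Q h x \<Longrightarrow> \<not> P (left h) x"
proof -
  obtain Q where Q: "semi Q" and P: "\<And>f x. P f x \<longleftrightarrow> (\<forall>g. Q (join f g) x)"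
    using assms unfolding pi11_def by blast
  have "semi (\<lambda>h x. Q (join (left h) (right h)) x)" by (intro semi_subst[OF Q] rec_intros)
  moreover have "(\<forall>f. P f x) \<longleftrightarrow> (\<forall>h. Q (join (left h) (right h)) x)" for x
  proof
    assume "\<forall>h. Q (join (left h) (right h)) x"
    then have "Q (join f g) x" for f g by (auto dest: spec[of _ "join f g"])
    then show "\<forall>f. P f x" by (simp add: P)
  qed (simp add: P)
  ultimately show thesis by (rule that) (use P in blast)
qed

lemma Pi11_forall_oracle:
  assumes "pi11 P" shows "Pi11 {x. \<forall>f. P f x}"
proof -
  obtain Q where Q: "semi Q" "\<And>x. (\<forall>f. P f x) \<longleftrightarrow> (\<forall>h. Q h x)"
    by (rule pi11_forall_oracle[OF assms]) (rule that)
  obtain p where "\<And>f x. Q f x \<longleftrightarrow> (\<exists>y. ev f p x y)"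
    by (rule semi_program[OF Q(1)]) (rule that)
  then show ?thesis unfolding Pi11_def using Q(2) by auto
qed

text \<open>Being closed under negation, this class contains every relation defined from computable ones by
  number quantifiers, without a detour through prenex forms.\<close>

definition delta11 :: "((nat \<Rightarrow> nat) \<Rightarrow> nat \<Rightarrow> bool) \<Rightarrow> bool" where
  "delta11 P \<longleftrightarrow> pi11 P \<and> pi11 (\<lambda>f x. \<not> P f x)"

named_theorems delta_intros

lemma delta11_recp:
  assumes "recp UNIV P" shows "delta11 P"
  unfolding delta11_def by (intro conjI pi11_semi semi_recp rec_intros assms)

lemma delta11_eq [delta_intros]: "recf UNIV F \<Longrightarrow> recf UNIV G \<Longrightarrow> delta11 (\<lambda>f x. F f x = G f x)"
  by (intro delta11_recp rec_intros)

lemma delta11_le [delta_intros]: "recf UNIV F \<Longrightarrow> recf UNIV G \<Longrightarrow> delta11 (\<lambda>f x. F f x \<le> G f x)"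
  by (intro delta11_recp rec_intros)

lemma delta11_less [delta_intros]: "recf UNIV F \<Longrightarrow> recf UNIV G \<Longrightarrow> delta11 (\<lambda>f x. F f x < G f x)"
  by (intro delta11_recp rec_intros)

lemma delta11_not [delta_intros]: "delta11 P \<Longrightarrow> delta11 (\<lambda>f x. \<not> P f x)"
  by (simp add: delta11_def)

lemma delta11_conj [delta_intros]: "delta11 P \<Longrightarrow> delta11 Q \<Longrightarrow> delta11 (\<lambda>f x. P f x \<and> Q f x)"
  unfolding delta11_def de_Morgan_conj de_Morgan_disj by (intro conjI pi11_conj pi11_disj) auto

lemma delta11_disj [delta_intros]: "delta11 P \<Longrightarrow> delta11 Q \<Longrightarrow> delta11 (\<lambda>f x. P f x \<or> Q f x)"
  unfolding delta11_def de_Morgan_conj de_Morgan_disj by (intro conjI pi11_conj pi11_disj) auto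

lemma delta11_imp [delta_intros]: "delta11 P \<Longrightarrow> delta11 Q \<Longrightarrow> delta11 (\<lambda>f x. P f x \<longrightarrow> Q f x)"
  unfolding imp_conv_disj by (intro delta11_disj delta11_not)

lemma delta11_iff [delta_intros]: "delta11 P \<Longrightarrow> delta11 Q \<Longrightarrow> delta11 (\<lambda>f x. P f x \<longleftrightarrow> Q f x)"
  unfolding iff_conv_conj_imp by (intro delta11_conj delta11_imp)

lemma delta11_all [delta_intros]:
  "delta11 (\<lambda>f z. P f (pfst z) (psnd z)) \<Longrightarrow> delta11 (\<lambda>f x. \<forall>n. P f x n)"
  unfolding delta11_def not_all not_ex by (intro conjI pi11_all pi11_ex) auto

lemma delta11_ex [delta_intros]:
  "delta11 (\<lambda>f z. P f (pfst z) (psnd z)) \<Longrightarrow> delta11 (\<lambda>f x. \<exists>n. P f x n)"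
  unfolding delta11_def not_all not_ex by (intro conjI pi11_all pi11_ex) auto

lemma delta11_semi:
  assumes "semi Q" shows "delta11 Q"
proof -
  obtain M where M: "recp UNIV M" and Q: "\<And>f x. Q f x \<longleftrightarrow> (\<exists>t. M f \<langle>x, t\<rangle>)"
    using assms unfolding semi_def by blast
  have "delta11 (\<lambda>f x. \<exists>t. M f \<langle>x, t\<rangle>)"
    by (intro delta11_ex delta11_recp recp_comp[OF M] rec_intros)
  then show ?thesis unfolding delta11_def Q .
qed

lemmas delta11_ev [delta_intros] = delta11_semi[OF semi_ev]

lemma delta11_phi [delta_intros]:
  "recf UNIV E \<Longrightarrow> recf UNIV X \<Longrightarrow> recf UNIV Y \<Longrightarrow> delta11 (\<lambda>f z. phi (E f z) (X f z) (Y f z))"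
  unfolding phi_def by (intro delta_intros rec_intros)

section \<open>Membership in $\Pi^1_1$\<close>

abbreviation halting_oracle :: "nat \<Rightarrow> nat" where
  "halting_oracle \<equiv> char_fun halting_set"

lemma zero_jump_computable_iff: "zero_jump_computable g \<longleftrightarrow> recf {halting_oracle} (\<lambda>_. g)"
  by (simp add: zero_jump_computable_def computable_in_def recf_def)

definition map_code :: "(nat \<Rightarrow> nat) \<Rightarrow> nat \<Rightarrow> nat" where
  "map_code f c = restr (\<lambda>j. f (nthc c j)) (lenc c)"

lemma list_decode_map_code: "list_decode (map_code f c) = map f (list_decode c)"
  by (rule nth_equalityI) (auto simp: map_code_def restr_def lenc_def nthc_nth)

lemma struct_of_list_decode: "struct_of e i (list_decode c) \<longleftrightarrow> phi e \<langle>i, c\<rangle> 1"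
  by (simp add: struct_of_def)

lemma all_list_decode: "(\<forall>xs. P xs) \<longleftrightarrow> (\<forall>c. P (list_decode c))"
  by (metis list_encode_inverse)

lemma is_embedding_struct_of_iff:
  "is_embedding f (struct_of a) (struct_of b) \<longleftrightarrow>
     (\<forall>x y. f x = f y \<longrightarrow> x = y) \<and> (\<forall>i c. phi a \<langle>i, c\<rangle> 1 \<longleftrightarrow> phi b \<langle>i, map_code f c\<rangle> 1)"
  unfolding is_embedding_def all_list_decode list_decode_map_code[symmetric] struct_of_list_decode
  by (simp add: inj_def)

text \<open>Only the graph of the program is mentioned, and the image tuple is quantified as
  \<open>d\<close> instead of computed, so the condition stays arithmetical in \<open>u\<close>,
  also for programs that are not total.\<close>

definition program_embeds :: "(nat \<Rightarrow> nat) \<Rightarrow> nat \<Rightarrow> nat \<Rightarrow> nat \<Rightarrow> bool" where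
  "program_embeds u p a b \<longleftrightarrow>
     (\<forall>x. \<exists>y. ev u (program p) x y) \<and>
     (\<forall>x x' y. ev u (program p) x y \<longrightarrow> ev u (program p) x' y \<longrightarrow> x = x') \<and>
     (\<forall>i c d. lenc c = lenc d \<longrightarrow> (\<forall>j. j < lenc c \<longrightarrow> ev u (program p) (nthc c j) (nthc d j)) \<longrightarrow>
        (phi a \<langle>i, c\<rangle> 1 \<longleftrightarrow> phi b \<langle>i, d\<rangle> 1))"

lemma program_embeds_iff:
  assumes "\<And>x. ev u (program p) x (f x)"
  shows "program_embeds u p a b \<longleftrightarrow> is_embedding f (struct_of a) (struct_of b)"
proof -
  have ev_iff: "ev u (program p) x y \<longleftrightarrow> y = f x" for x y
    using assms ev_deterministic by blast
  have map_code: "d = map_code f c"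
    if "lenc c = lenc d" "\<forall>j. j < lenc c \<longrightarrow> nthc d j = f (nthc c j)" for c d
    by (rule code_eqI) (use that in \<open>simp_all add: map_code_def\<close>)
  have "(\<forall>c d. lenc c = lenc d \<longrightarrow> (\<forall>j. j < lenc c \<longrightarrow> nthc d j = f (nthc c j)) \<longrightarrow> R c d) \<longleftrightarrow>
      (\<forall>c. R c (map_code f c))" (is "?L \<longleftrightarrow> ?R") for R
  proof
    assume ?L then show ?R by (simp add: map_code_def)
  next
    assume ?R then show ?L using map_code by blast
  qed
  then show ?thesis
    unfolding program_embeds_def is_embedding_struct_of_iff ev_iff by simp
qed

text \<open>An embedding computable from the halting problem is given by a program, so a function
  quantifier becomes a number quantifier. This keeps the conclusion of categoricity
  arithmetical.\<close>

lemma ex_program_embeds_iff: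
  "(\<exists>f. zero_jump_computable f \<and> is_embedding f (struct_of a) (struct_of b)) \<longleftrightarrow>
   (\<exists>p. program_embeds halting_oracle p a b)"
proof
  assume "\<exists>f. zero_jump_computable f \<and> is_embedding f (struct_of a) (struct_of b)"
  then obtain f p where p: "\<And>x. ev halting_oracle p x (f x)"
    and f: "is_embedding f (struct_of a) (struct_of b)"
    unfolding zero_jump_computable_def computable_in_def by blast
  have "program_embeds halting_oracle (enc p) a b" using program_embeds_iff[of _ "enc p" f] p f by simp
  then show "\<exists>p. program_embeds halting_oracle p a b" ..
next
  assume "\<exists>p. program_embeds halting_oracle p a b"
  then obtain p where p: "program_embeds halting_oracle p a b" ..
  then have "\<forall>x. \<exists>y. ev halting_oracle (program p) x y" by (simp add: program_embeds_def)
  then obtain f where f: "\<And>x. ev halting_oracle (program p) x (f x)" by metis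
  then have "zero_jump_computable f" unfolding zero_jump_computable_def computable_in_def by blast
  then show "\<exists>f. zero_jump_computable f \<and> is_embedding f (struct_of a) (struct_of b)"
    using p program_embeds_iff[OF f] by blast
qed

text \<open>An arithmetical condition that determines \<open>u\<close>: the halting problem can then
  enter as one more universally quantified function.\<close>

definition is_halting_oracle :: "(nat \<Rightarrow> nat) \<Rightarrow> bool" where
  "is_halting_oracle u \<longleftrightarrow> (\<forall>n. u n = 1 \<and> (\<exists>y. phi n n y) \<or> u n = 0 \<and> \<not> (\<exists>y. phi n n y))"

lemma is_halting_oracle_iff: "is_halting_oracle u \<longleftrightarrow> u = halting_oracle"
  unfolding is_halting_oracle_def fun_eq_iff char_fun_def halting_set_def by (rule iff_allI) auto

lemma recf_left_right [rec_intros]: "recf \<O> N \<Longrightarrow> recf \<O> (\<lambda>f x. left (right f) (N f x))"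
  unfolding left_def right_def by (intro rec_intros)

lemma recf_right_right [rec_intros]: "recf \<O> N \<Longrightarrow> recf \<O> (\<lambda>f x. right (right f) (N f x))"
  unfolding right_def by (intro rec_intros)

text \<open>\<open>f\<close> packs a candidate for the halting problem and the two embeddings that
  witness bi-embeddability.\<close>

definition categorical_matrix :: "(nat \<Rightarrow> nat) \<Rightarrow> nat \<Rightarrow> bool" where
  "categorical_matrix f e \<longleftrightarrow> is_structure_index e \<and>
     (\<forall>a. is_halting_oracle (left f) \<and> is_structure_index a \<and>
        is_embedding (left (right f)) (struct_of a) (struct_of e) \<and>
        is_embedding (right (right f)) (struct_of e) (struct_of a) \<longrightarrow>
        (\<exists>p. program_embeds (left f) p a e) \<and> (\<exists>p. program_embeds (left f) p e a))"

lemma categorical_iff_matrix: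
  "is_structure_index e \<and> zero_jump_cbe_categorical (struct_of e) \<longleftrightarrow> (\<forall>f. categorical_matrix f e)"
proof
  assume "is_structure_index e \<and> zero_jump_cbe_categorical (struct_of e)"
  then show "\<forall>f. categorical_matrix f e"
    unfolding zero_jump_cbe_categorical_def ex_program_embeds_iff categorical_matrix_def
      is_halting_oracle_iff bi_embeddable_def by metis
next
  assume M: "\<forall>f. categorical_matrix f e"
  have "(\<exists>p. program_embeds halting_oracle p a e) \<and> (\<exists>p. program_embeds halting_oracle p e a)"
    if "is_structure_index a" "is_embedding f (struct_of a) (struct_of e)"
      "is_embedding g (struct_of e) (struct_of a)" for a f g
    using M[rule_format, of "join halting_oracle (join f g)"] that
    by (simp add: categorical_matrix_def is_halting_oracle_iff)
  then show "is_structure_index e \<and> zero_jump_cbe_categorical (struct_of e)"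
    using M unfolding zero_jump_cbe_categorical_def ex_program_embeds_iff bi_embeddable_def
      categorical_matrix_def by blast
qed

lemma delta11_categorical_matrix: "delta11 categorical_matrix"
  unfolding categorical_matrix_def is_structure_index_def is_halting_oracle_def
    is_embedding_struct_of_iff program_embeds_def map_code_def
  by (intro delta_intros rec_intros)

lemma Pi11_categorical: "Pi11 {e. is_structure_index e \<and> zero_jump_cbe_categorical (struct_of e)}"
  unfolding categorical_iff_matrix
  using delta11_categorical_matrix Pi11_forall_oracle by (simp add: delta11_def)

section \<open>Trees without paths computable from the halting problem\<close>

text \<open>The oracle is made to carry, besides the original one, the halting problem and a function that
  diagonalizes against everything computable from it.\<close>

lemma Pi11_avoiding_zero_jump:
  assumes "Pi11 T"
  obtains D where "\<forall>\<O>. recp \<O> (\<lambda>f z. D (pfst z) (psnd z))"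
    "\<And>x. x \<in> T \<longleftrightarrow> (\<forall>h. \<exists>t. D (restr h t) x)"
    "\<And>x h. \<forall>t. \<not> D (restr h t) x \<Longrightarrow> \<not> zero_jump_computable h"
proof -
  obtain p where T: "\<And>x. x \<in> T \<longleftrightarrow> (\<forall>f. \<exists>y. ev f p x y)"
    using assms unfolding Pi11_def by blast
  \<comment> \<open>The middle component is never the output of a program run on its own index with
    the halting problem as oracle, so it is not computable from the halting problem.\<close>
  define N where "N f \<longleftrightarrow> is_halting_oracle (left f) \<and>
    (\<forall>e. \<not> ev (left f) (program e) e (left (right f) e))" for f
  define P where "P f x \<longleftrightarrow> (N f \<longrightarrow> (\<exists>y. ev (right (right f)) (program (enc p)) x y))" for f x
  have "delta11 P"
    unfolding P_def N_def is_halting_oracle_def by (intro delta_intros rec_intros)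
  then have "pi11 P" by (simp add: delta11_def)
  then obtain Q where Q: "semi Q" "\<And>x. (\<forall>f. P f x) \<longleftrightarrow> (\<forall>h. Q h x)"
    and notQ: "\<And>h x. \<not> Q h x \<Longrightarrow> \<not> P (left h) x"
    by (rule pi11_forall_oracle) (rule that)
  obtain D where D: "\<forall>\<O>. recp \<O> (\<lambda>f z. D (pfst z) (psnd z))"
    "\<And>f x. Q f x \<longleftrightarrow> (\<exists>t. D (restr f t) x)"
    using Q(1) by (rule semi_normal_form) (rule that)
  \<comment> \<open>Some function does satisfy the condition: 1 where the program outputs 0, and 0
    otherwise. So restricting to oracles with \<open>N\<close> leaves \<open>T\<close>
    unchanged.\<close>
  define w where "w e = (of_bool (ev halting_oracle (program e) e 0) :: nat)" for e
  have w: "\<not> ev halting_oracle (program e) e (w e)" for e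
  proof
    assume ev: "ev halting_oracle (program e) e (w e)"
    then show False
      using ev_deterministic[OF ev, of 0] by (cases "ev halting_oracle (program e) e 0") (auto simp: w_def)
  qed
  have PT: "(\<forall>f. P f x) \<longleftrightarrow> x \<in> T" for x
  proof
    assume P: "\<forall>f. P f x"
    have "\<exists>y. ev g p x y" for g
      using P[rule_format, of "join halting_oracle (join w g)"] w
      by (simp add: P_def N_def is_halting_oracle_iff)
    then show "x \<in> T" by (simp add: T)
  qed (simp add: P_def T)
  have no_zero_jump: "\<not> zero_jump_computable h" if "\<forall>t. \<not> D (restr h t) x" for x h
  proof
    assume "zero_jump_computable h"
    then have h: "recf {halting_oracle} (\<lambda>_. h)" by (simp add: zero_jump_computable_iff)
    \<comment> \<open>A path computable from the halting problem would compute the diagonal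
      component, which fails at the index of that very program.\<close>
    have "recf {halting_oracle} (\<lambda>_ n. left (right (left h)) n)"
      unfolding left_def right_def by (intro recf_comp[OF h] rec_intros)
    then obtain q where q: "\<And>n. ev halting_oracle q n (left (right (left h)) n)"
      unfolding recf_def by blast
    have "N (left h)" using that notQ D(2) P_def by blast
    then have "\<not> ev halting_oracle (program (enc q)) (enc q) (left (right (left h)) (enc q))"
      unfolding N_def is_halting_oracle_iff by metis
    then show False using q by simp
  qed
  have "x \<in> T \<longleftrightarrow> (\<forall>h. \<exists>t. D (restr h t) x)" for x
    using PT Q(2) D(2) by simp
  then show thesis by (rule that[OF D(1) _ no_zero_jump])
qed

text \<open>The core of an s-m-n argument: the code of a constant program is computable from the
  constant, 7 being the tag of \<open>Comp_p\<close> and the pair of 1 and 0 the code of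
  \<open>Suc_p\<close>.\<close>

lemma enc_const_prog: "enc (const_prog c) = rec_nat \<langle>0, 0\<rangle> (\<lambda>k r. \<langle>7, \<langle>\<langle>1, 0\<rangle>, r\<rangle>\<rangle>) c"
  by (induction c) auto

text \<open>The halting problem answers \<open>\<Sigma>\<^sub>1\<close> questions: \<open>\<exists>k. M c k\<close> holds iff the program that
  ignores its input and searches for such a \<open>k\<close> halts.\<close>

lemma recp_halting_oracle_ex:
  assumes "recp {no_oracle} (\<lambda>f z. M (pfst z) (psnd z))" "recf {halting_oracle} C"
  shows "recp {halting_oracle} (\<lambda>f x. \<exists>k. M (C f x) k)"
proof -
  have "recp {no_oracle} (\<lambda>f z. \<not> M (pfst z) (psnd z))" by (intro rec_intros assms(1))
  then obtain p where p: "\<And>z. ev no_oracle p z (of_bool (\<not> M (pfst z) (psnd z)))"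
    unfolding recp_def recf_def by auto
  define idx where "idx c = enc (Comp_p (Mu_p p) (const_prog c))" for c
  have program_idx: "program (idx c) = Comp_p (Mu_p p) (const_prog c)" for c
    unfolding idx_def by (rule program_enc)
  have "idx c \<in> halting_set \<longleftrightarrow> (\<exists>k. M c k)" for c
  proof
    assume "idx c \<in> halting_set"
    then obtain y b where b: "ev no_oracle (const_prog c) (idx c) b" and y: "ev no_oracle (Mu_p p) b y"
      unfolding halting_set_def phi_def by (auto simp: program_idx elim!: ev_CompE)
    have "b = c" using ev_deterministic[OF b ev_const_prog] .
    with y have "ev no_oracle p \<langle>c, y\<rangle> 0" by (auto elim: ev_MuE)
    from ev_deterministic[OF this p] show "\<exists>k. M c k" by (auto intro!: exI[of _ y])
  next
    assume "\<exists>k. M c k"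
    then have "ev no_oracle (Mu_p p) c (LEAST k. M c k)"
      using p[of "\<langle>c, _\<rangle>"] by (intro ev_Mu_Least) auto
    then show "idx c \<in> halting_set"
      unfolding halting_set_def phi_def mem_Collect_eq program_idx using ev_Comp[OF ev_const_prog] by blast
  qed
  then have "halting_oracle (idx c) = of_bool (\<exists>k. M c k)" for c
    by (simp add: char_fun_def)
  moreover have "recf {halting_oracle} (\<lambda>f x. f (idx (C f x)))"
    unfolding idx_def enc.simps enc_const_prog by (intro rec_intros assms(2))
  ultimately show ?thesis
    unfolding recp_def by (subst recf_cong[of _ _ "\<lambda>f x. f (idx (C f x))"]) auto
qed

text \<open>On a structure index the value is 0 or 1, so failing to be 1 means being 0; both sides
  are semidecidable and Post's theorem applies.\<close>

lemma recp_phi_index: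
  assumes "is_structure_index a" "recf \<O> F"
  shows "recp \<O> (\<lambda>f x. phi a (F f x) 1)"
proof -
  have semi: "semi (\<lambda>f x. phi a x b)" for b unfolding phi_def by (intro semi_ev rec_intros)
  have "\<not> phi a x 1 \<longleftrightarrow> phi a x 0" for x
  proof -
    obtain y where y: "phi a x y" "y \<le> 1"
      using assms(1) unfolding is_structure_index_def by blast
    have "phi a x 0 \<Longrightarrow> phi a x 1 \<Longrightarrow> False"
      unfolding phi_def using ev_deterministic[of no_oracle "program a" x 0 1] by simp
    moreover have "phi a x 0 \<or> phi a x 1" using y by (cases "y = 0") (auto simp: le_Suc_eq)
    ultimately show ?thesis by blast
  qed
  then have "recp UNIV (\<lambda>f x. phi a x 1)"
    using semi by (intro recp_if_semi_semi_not) simp_all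
  from recp_comp[OF recp_mono[OF this] assms(2)] show ?thesis by simp
qed

section \<open>The structure of a tree\<close>

definition prefix_code :: "nat \<Rightarrow> nat \<Rightarrow> bool" where
  "prefix_code c d \<longleftrightarrow> lenc c \<le> lenc d \<and> (\<forall>j<lenc c. nthc c j = nthc d j)"

text \<open>Labels and names of blocks share one set of tagged codes, with tag 0 for nodes and tag 1
  for all other numbers. For a block name \<open>l\<close>, \<open>below k l\<close> amounts to the
  label \<open>k\<close> occurring in that block.\<close>

definition below :: "nat \<Rightarrow> nat \<Rightarrow> bool" where
  "below k l \<longleftrightarrow> k = l \<or> pfst k = 0 \<and> pfst l = 0 \<and> prefix_code (psnd k) (psnd l)"

text \<open>\<open>B\<close> marks where branches are cut off: the tree consists of the sequences
  with no marked initial segment.\<close>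

definition is_path :: "(nat \<Rightarrow> bool) \<Rightarrow> (nat \<Rightarrow> nat) \<Rightarrow> bool" where
  "is_path B h \<longleftrightarrow> (\<forall>t. \<not> B (restr h t))"

definition node :: "(nat \<Rightarrow> bool) \<Rightarrow> nat \<Rightarrow> bool" where
  "node B c \<longleftrightarrow> (\<forall>t\<le>lenc c. \<not> B (restr (nthc c) t))"

text \<open>Every node \<open>c\<close> gives rise to a block, whose elements \<open>\<langle>c, r\<rangle>\<close> are labelled by the prefixes
  \<open>r\<close> of \<open>c\<close>. All remaining numbers are blocks by themselves, with a label of their own.\<close>

definition tree_elem :: "(nat \<Rightarrow> bool) \<Rightarrow> nat \<Rightarrow> bool" where
  "tree_elem B n \<longleftrightarrow> node B (pfst n) \<and> prefix_code (psnd n) (pfst n)"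

definition lab :: "(nat \<Rightarrow> bool) \<Rightarrow> nat \<Rightarrow> nat" where
  "lab B n = (if tree_elem B n then \<langle>0, psnd n\<rangle> else \<langle>1, n\<rangle>)"

text \<open>A block is named by its largest label, so the element carrying the name as label records
  the whole block.\<close>

definition blk :: "(nat \<Rightarrow> bool) \<Rightarrow> nat \<Rightarrow> nat" where
  "blk B n = (if tree_elem B n then \<langle>0, pfst n\<rangle> else \<langle>1, n\<rangle>)"

definition tree_struct :: "(nat \<Rightarrow> bool) \<Rightarrow> struc" where
  "tree_struct B i xs \<longleftrightarrow>
     length xs = 1 \<and> lab B (xs ! 0) = i \<or> length xs = 2 \<and> blk B (xs ! 0) = blk B (xs ! 1)"

lemma tree_struct_simps [simp]:
  "tree_struct B i [n] \<longleftrightarrow> lab B n = i"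
  "tree_struct B i [n, m] \<longleftrightarrow> blk B n = blk B m"
  by (simp_all add: tree_struct_def)

lemma prefix_code_trans: "prefix_code c d \<Longrightarrow> prefix_code d e \<Longrightarrow> prefix_code c e"
  unfolding prefix_code_def by force

lemma prefix_code_eqI: "prefix_code c d \<Longrightarrow> lenc d \<le> lenc c \<Longrightarrow> c = d"
  by (rule code_eqI) (auto simp: prefix_code_def)

lemma prefix_code_restr: "s \<le> t \<Longrightarrow> prefix_code (restr h s) (restr h t)"
  by (simp add: prefix_code_def)

lemma below_refl: "below k k"
  by (simp add: below_def)

lemma below_antisym:
  assumes "below k l" "below l k" shows "k = l"
proof (rule ccontr)
  assume "k \<noteq> l"
  then have "pfst k = pfst l" "prefix_code (psnd k) (psnd l)" "prefix_code (psnd l) (psnd k)"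
    using assms by (auto simp: below_def)
  then have "pfst k = pfst l" "psnd k = psnd l"
    by (auto simp: prefix_code_def intro!: prefix_code_eqI)
  then show False using \<open>k \<noteq> l\<close> by (metis pair_code_collapse)
qed

lemma node_restr:
  assumes "is_path B h" shows "node B (restr h t)"
proof -
  have "restr (nthc (restr h t)) s = restr h s" if "s \<le> t" for s
    using that by (intro restr_cong) simp
  then show ?thesis using assms by (simp add: node_def is_path_def)
qed

lemma below_lab_blk: "below (lab B n) (blk B n)"
  by (simp add: below_def lab_def blk_def tree_elem_def)

lemma lab_blk_inj: "lab B n = lab B m \<Longrightarrow> blk B n = blk B m \<Longrightarrow> n = m"
  by (auto simp: lab_def blk_def split: if_splits) (metis pair_code_collapse)

lemma ex_lab_below:
  assumes "below l (blk B n)" shows "\<exists>m. blk B m = blk B n \<and> lab B m = l"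
proof (cases "tree_elem B n")
  case True
  then have l: "pfst l = 0" "prefix_code (psnd l) (pfst n)"
    using assms by (auto simp: below_def blk_def prefix_code_def)
  then have "tree_elem B \<langle>pfst n, psnd l\<rangle>" using True by (simp add: tree_elem_def)
  then show ?thesis using True l
    by (intro exI[of _ "\<langle>pfst n, psnd l\<rangle>"]) (simp add: blk_def lab_def pair_code_eq_iff)
next
  case False
  then have "l = lab B n" using assms by (auto simp: below_def blk_def lab_def)
  then show ?thesis by blast
qed

section \<open>Self-embeddings of tree structures\<close>

lemma tree_struct_embeddingD:
  assumes "is_embedding h (tree_struct B) (tree_struct B)"
  shows "lab B (h n) = lab B n" "blk B (h n) = blk B (h m) \<longleftrightarrow> blk B n = blk B m"
proof -
  have h: "tree_struct B i xs \<longleftrightarrow> tree_struct B i (map h xs)" for i xs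
    using assms by (simp add: is_embedding_def)
  show "lab B (h n) = lab B n" using h[of "lab B n" "[n]"] by simp
  show "blk B (h n) = blk B (h m) \<longleftrightarrow> blk B n = blk B m" using h[of 0 "[n, m]"] by simp
qed

lemma tree_struct_embeddingI:
  assumes lab: "\<And>n. lab B (h n) = lab B n"
    and blk: "\<And>n m. blk B (h n) = blk B (h m) \<longleftrightarrow> blk B n = blk B m"
  shows "is_embedding h (tree_struct B) (tree_struct B)"
  unfolding is_embedding_def
proof (intro conjI allI)
  show "inj h" by (rule injI) (metis lab blk lab_blk_inj)
  show "tree_struct B i xs \<longleftrightarrow> tree_struct B i (map h xs)" for i xs
    by (auto simp: tree_struct_def lab blk)
qed

text \<open>The element labelled by the name of its block keeps that label under \<open>h\<close>,
  and every label lies below the name of the block containing it.\<close>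

lemma below_blk_embedding:
  assumes "is_embedding h (tree_struct B) (tree_struct B)"
  shows "below (blk B n) (blk B (h n))"
proof -
  obtain m where "blk B m = blk B n" "lab B m = blk B n"
    using ex_lab_below[OF below_refl] by blast
  then have "lab B (h m) = blk B n" "blk B (h m) = blk B (h n)"
    using tree_struct_embeddingD[OF assms] by metis+
  then show ?thesis using below_lab_blk by metis
qed

text \<open>An embedding moves each block to itself or to a proper extension. In the latter case, being
  injective on blocks, it has to move that extension as well, and so on.\<close>

lemma path_of_embedding:
  assumes h: "is_embedding h (tree_struct B) (tree_struct B)" and n: "blk B (h n) \<noteq> blk B n"
  shows "is_path B (\<lambda>k. nthc (pfst ((h ^^ Suc k) n)) k)"
proof -
  define c where "c k = pfst ((h ^^ k) n)" for k
  have moved: "blk B ((h ^^ Suc k) n) \<noteq> blk B ((h ^^ k) n)" for k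
    by (induction k) (use n tree_struct_embeddingD(2)[OF h] in auto)
  have step: "tree_elem B ((h ^^ k) n) \<and> prefix_code (c k) (c (Suc k)) \<and> c k \<noteq> c (Suc k)" for k
  proof -
    let ?m = "(h ^^ k) n"
    have "below (blk B ?m) (blk B (h ?m))" by (rule below_blk_embedding[OF h])
    moreover have "blk B ?m \<noteq> blk B (h ?m)" using moved[of k] by auto
    ultimately show ?thesis by (auto simp: below_def blk_def c_def split: if_splits)
  qed
  \<comment> \<open>Proper extensions increase the length, so \<open>c (Suc k)\<close> has an entry
    at position \<open>k\<close>; hence the \<open>Suc\<close> in the formula for the path.\<close>
  have lenc_c: "k \<le> lenc (c k)" for k
  proof (induction k)
    case (Suc k)
    have "lenc (c k) < lenc (c (Suc k))"
      using step[of k] prefix_code_eqI[of "c k" "c (Suc k)"] by (meson not_le)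
    then show ?case using Suc by simp
  qed simp
  have prefix: "prefix_code (c i) (c k)" if "i \<le> k" for i k
    using that
  proof (induction k rule: dec_induct)
    case base
    show ?case by (simp add: prefix_code_def)
  next
    case (step k)
    then show ?case using \<open>\<And>k. tree_elem B ((h ^^ k) n) \<and> _\<close> prefix_code_trans by blast
  qed
  show ?thesis
    unfolding is_path_def
  proof
    fix t
    have "nthc (c (Suc j)) j = nthc (c t) j" if "j < t" for j
      using prefix[of "Suc j" t] lenc_c[of "Suc j"] that by (simp add: prefix_code_def)
    then have "restr (\<lambda>k. nthc (pfst ((h ^^ Suc k) n)) k) t = restr (nthc (c t)) t"
      by (intro restr_cong) (simp add: c_def)
    moreover have "node B (c t)" using step[of t] by (simp add: tree_elem_def c_def)
    ultimately show "\<not> B (restr (\<lambda>k. nthc (pfst ((h ^^ Suc k) n)) k) t)"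
      using lenc_c[of t] by (simp add: node_def)
  qed
qed

lemma rigid_if_no_path:
  assumes "\<nexists>h. is_path B h" "is_embedding h (tree_struct B) (tree_struct B)"
  shows "h n = n"
  using path_of_embedding[OF assms(2)] assms(1) tree_struct_embeddingD(1)[OF assms(2)] lab_blk_inj
  by metis

lemma is_embedding_comp:
  assumes "is_embedding f R S" "is_embedding g S T" shows "is_embedding (g \<circ> f) R T"
  using assms by (auto simp: is_embedding_def intro: inj_compose)

section \<open>Computability of tree structures and their indices\<close>

lemma recp_prefix_code [rec_intros]:
  "recf \<O> F \<Longrightarrow> recf \<O> G \<Longrightarrow> recp \<O> (\<lambda>f x. prefix_code (F f x) (G f x))"
proof -
  assume FG: "recf \<O> F" "recf \<O> G"
  have "recp \<O> (\<lambda>f z. prefix_code (pfst z) (psnd z))"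
    unfolding prefix_code_def by (intro rec_intros)
  from recp_comp[OF this, of "\<lambda>f x. \<langle>F f x, G f x\<rangle>"] show ?thesis
    using FG by (simp add: rec_intros)
qed

lemma recp_below [rec_intros]:
  "recf \<O> F \<Longrightarrow> recf \<O> G \<Longrightarrow> recp \<O> (\<lambda>f x. below (F f x) (G f x))"
  unfolding below_def by (intro rec_intros)

lemma recp_tree_elem:
  assumes D: "recp \<O> (\<lambda>f z. D (pfst z) (psnd z))" and "recf \<O> X" "recf \<O> N"
  shows "recp \<O> (\<lambda>f w. tree_elem (\<lambda>s. D s (X f w)) (N f w))"
proof -
  have D': "recp \<O> (\<lambda>f w. D (F f w) (G f w))" if "recf \<O> F" "recf \<O> G" for F G
    using recp_comp[OF D, of "\<lambda>f w. \<langle>F f w, G f w\<rangle>"] that by (simp add: rec_intros)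
  have "recp \<O> (\<lambda>f z. tree_elem (\<lambda>s. D s (pfst z)) (psnd z))"
    unfolding tree_elem_def node_def by (intro rec_intros D')
  from recp_comp[OF this, of "\<lambda>f w. \<langle>X f w, N f w\<rangle>"] show ?thesis
    using assms(2,3) by (simp add: rec_intros)
qed

lemma recf_lab:
  assumes "recp \<O> (\<lambda>f z. D (pfst z) (psnd z))" "recf \<O> X" "recf \<O> N"
  shows "recf \<O> (\<lambda>f w. lab (\<lambda>s. D s (X f w)) (N f w))"
  unfolding lab_def by (intro rec_intros recp_tree_elem assms)

lemma recf_blk:
  assumes "recp \<O> (\<lambda>f z. D (pfst z) (psnd z))" "recf \<O> X" "recf \<O> N"
  shows "recf \<O> (\<lambda>f w. blk (\<lambda>s. D s (X f w)) (N f w))"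
  unfolding blk_def by (intro rec_intros recp_tree_elem assms)

lemma tree_struct_map_list_decode:
  "tree_struct B i (map g (list_decode c)) \<longleftrightarrow>
     lenc c = 1 \<and> lab B (g (nthc c 0)) = i \<or>
     lenc c = 2 \<and> blk B (g (nthc c 0)) = blk B (g (nthc c 1))"
proof -
  have "length (list_decode c) = Suc 0 \<Longrightarrow> nthc c 0 = list_decode c ! 0"
    "length (list_decode c) = 2 \<Longrightarrow> nthc c 0 = list_decode c ! 0"
    "length (list_decode c) = 2 \<Longrightarrow> nthc c (Suc 0) = list_decode c ! Suc 0"
    by (simp_all add: nthc_nth lenc_def)
  then show ?thesis by (auto simp: tree_struct_def lenc_def)
qed

text \<open>The map \<open>g\<close> pulls the structure back: the identity gives all of it,
  \<open>Suc\<close> the part on the positive numbers.\<close>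

lemma recp_tree_struct:
  assumes "recp \<O> (\<lambda>f z. D (pfst z) (psnd z))" "recf \<O> (\<lambda>f. g)"
  shows "recp \<O> (\<lambda>f z. tree_struct (\<lambda>s. D s (pfst z)) (pfst (psnd z)) (map g (list_decode (psnd (psnd z)))))"
  unfolding tree_struct_map_list_decode
  by (intro rec_intros recf_lab recf_blk recf_comp[OF assms(2)] assms(1))

text \<open>A constant program builds the parameter \<open>x\<close> into the code, which depends
  computably on \<open>x\<close>. This supplies the reduction function.\<close>

lemma ex_structure_indices:
  assumes "recp {no_oracle} (\<lambda>f z. R (pfst z) (pfst (psnd z)) (list_decode (psnd (psnd z))))"
  shows "\<exists>p. \<forall>x. \<exists>e. ev no_oracle p x e \<and> is_structure_index e \<and> struct_of e = R x"
proof -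
  obtain q where q: "\<And>z. ev no_oracle q z (of_bool (R (pfst z) (pfst (psnd z)) (list_decode (psnd (psnd z)))))"
    using assms unfolding recp_def recf_def by auto
  define idx where "idx x = enc (Comp_p q (Pair_p (const_prog x) Id_p))" for x
  have ev: "ev no_oracle (program (idx x)) z (of_bool (R x (pfst z) (list_decode (psnd z))))" for x z
    unfolding idx_def program_enc
    using ev_Comp[OF ev_Pair[OF ev_const_prog ev_Id] q[of "\<langle>x, z\<rangle>"]] by simp
  have "is_structure_index (idx x)" for x
    unfolding is_structure_index_def phi_def using ev by (meson of_bool_less_eq_one)
  moreover have "struct_of (idx x) i xs \<longleftrightarrow> R x i xs" for x i xs
  proof -
    have "phi (idx x) \<langle>i, list_encode xs\<rangle> y \<longleftrightarrow> y = of_bool (R x i xs)" for y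
      using ev[of x "\<langle>i, list_encode xs\<rangle>"] ev_deterministic unfolding phi_def by auto
    then show ?thesis by (simp add: struct_of_def)
  qed
  moreover have "recf {no_oracle} (\<lambda>f x. idx x)"
    unfolding idx_def enc.simps enc_const_prog by (intro rec_intros)
  then obtain p where "\<And>x. ev no_oracle p x (idx x)" unfolding recf_def by auto
  ultimately show ?thesis by (intro exI[of _ p] allI exI[of _ "idx _"]) (auto simp: fun_eq_iff)
qed

section \<open>Categoricity and the absence of paths\<close>

lemma categorical_if_no_path:
  assumes B: "\<forall>\<O>. recp \<O> (\<lambda>f. B)" and no_path: "\<nexists>h. is_path B h"
  shows "zero_jump_cbe_categorical (tree_struct B)"
  unfolding zero_jump_cbe_categorical_def
proof (intro allI impI)
  fix a
  assume a: "is_structure_index a \<and> bi_embeddable (struct_of a) (tree_struct B)"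
  let ?A = "struct_of a"
  obtain F G where F: "is_embedding F ?A (tree_struct B)" and G: "is_embedding G (tree_struct B) ?A"
    using a unfolding bi_embeddable_def by blast
  \<comment> \<open>\<open>F\<close> after \<open>G\<close> is a self-embedding, hence the identity
    by rigidity; as \<open>F\<close> is injective, \<open>G\<close> is its inverse.\<close>
  have FG: "F (G n) = n" for n
    using rigid_if_no_path[OF no_path is_embedding_comp[OF G F]] by simp
  then have GF: "G (F b) = b" for b
    using F by (metis is_embedding_def injD)
  have A1: "?A i [b] \<longleftrightarrow> lab B (F b) = i" and A2: "?A i [b, c] \<longleftrightarrow> blk B (F b) = blk B (F c)" for i b c
    using F unfolding is_embedding_def by simp_all
  \<comment> \<open>A witness shows that the block of \<open>F b\<close> contains the label naming
    the block of \<open>n\<close>, hence equals or extends it.\<close>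
  define M where "M z b \<longleftrightarrow> ?A 0 [pfst z, b] \<and> ?A (blk B (psnd z)) [b]" for z b
  \<comment> \<open>A witness pairs an element with its label and shows that the block of
    \<open>F b\<close> has a label strictly above the block of \<open>n\<close>.\<close>
  define N where "N z w \<longleftrightarrow> ?A 0 [pfst z, pfst w] \<and> ?A (psnd w) [pfst w] \<and>
    below (blk B (psnd z)) (psnd w) \<and> blk B (psnd z) \<noteq> psnd w" for z w
  \<comment> \<open>Together the last two conjuncts say that the blocks of \<open>F b\<close> and
    \<open>n\<close> agree; the halting problem answers both existential questions.\<close>
  define P where "P b n \<longleftrightarrow> ?A (lab B n) [b] \<and> (\<exists>c. M \<langle>b, n\<rangle> c) \<and> \<not> (\<exists>w. N \<langle>b, n\<rangle> w)" for b n
  have P_iff: "P b n \<longleftrightarrow> F b = n" for b n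
  proof
    assume P: "P b n"
    then obtain c where c: "lab B (F b) = lab B n" "blk B (F b) = blk B (F c)" "lab B (F c) = blk B n"
      by (auto simp: P_def M_def A1 A2)
    then have below: "below (blk B n) (blk B (F b))" using below_lab_blk[of B "F c"] by simp
    have "blk B n = blk B (F b)"
    proof (rule ccontr)
      assume neq: "blk B n \<noteq> blk B (F b)"
      obtain m where "blk B m = blk B (F b)" "lab B m = blk B (F b)"
        using ex_lab_below[OF below_refl] by blast
      then have "N \<langle>b, n\<rangle> \<langle>G m, blk B (F b)\<rangle>" using below neq by (simp add: N_def A1 A2 FG)
      then show False using P by (auto simp: P_def)
    qed
    then show "F b = n" using c(1) lab_blk_inj by metis
  next
    assume n: "F b = n"
    obtain m where "blk B m = blk B n" "lab B m = blk B n"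
      using ex_lab_below[OF below_refl] by blast
    then have "M \<langle>b, n\<rangle> (G m)" using n by (simp add: M_def A1 A2 FG)
    moreover have "\<not> N \<langle>b, n\<rangle> w" for w
      using n below_antisym below_lab_blk[of B "F (pfst w)"] by (auto simp: N_def A1 A2)
    ultimately show "P b n" using n by (auto simp: P_def A1)
  qed
  have B': "recp \<O> (\<lambda>f z. B (pfst z))" for \<O>
    using recp_comp[OF spec[OF B], of \<O> "\<lambda>f z. pfst z"] by (simp add: rec_intros)
  have lab: "recf \<O> (\<lambda>f x. lab B (X f x))" and blk: "recf \<O> (\<lambda>f x. blk B (X f x))"
    if "recf \<O> X" for \<O> X
    using recf_lab[OF B' that that] recf_blk[OF B' that that] by simp_all
  have A1_rec: "recp \<O> (\<lambda>f x. ?A (I f x) [X f x])" if "recf \<O> I" "recf \<O> X" for \<O> I X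
    unfolding struct_of_def list_encode.simps
    by (intro recp_phi_index[OF conjunct1[OF a]] rec_intros that)
  have A2_rec: "recp \<O> (\<lambda>f x. ?A 0 [X f x, Y f x])" if "recf \<O> X" "recf \<O> Y" for \<O> X Y
    unfolding struct_of_def list_encode.simps
    by (intro recp_phi_index[OF conjunct1[OF a]] rec_intros that)
  have "recp {no_oracle} (\<lambda>f z. M (pfst z) (psnd z))" "recp {no_oracle} (\<lambda>f z. N (pfst z) (psnd z))"
    unfolding M_def N_def by (intro rec_intros A1_rec A2_rec blk)+
  note ex_rec = this[THEN recp_halting_oracle_ex]
  have "recp {halting_oracle} (\<lambda>f z. P (pfst z) (psnd z))"
    unfolding P_def by (intro rec_intros ex_rec A1_rec lab)
  then have "recf {halting_oracle} (\<lambda>f b. LEAST n. P b n)"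
    by (rule recf_Least) (simp add: P_iff)
  moreover have "(LEAST n. P b n) = F b" for b
    unfolding P_iff by (rule Least_equality) auto
  ultimately have F_rec: "recf {halting_oracle} (\<lambda>f. F)" by simp
  have "recp {halting_oracle} (\<lambda>f z. F (psnd z) = pfst z)"
    by (intro rec_intros recf_comp[OF F_rec])
  then have "recf {halting_oracle} (\<lambda>f n. LEAST b. F b = n)"
    using FG by (intro recf_Least) auto
  moreover have "(LEAST b. F b = n) = G n" for n
    using FG GF by (intro Least_equality) auto
  ultimately have G_rec: "recf {halting_oracle} (\<lambda>f. G)" by simp
  show "(\<exists>f. zero_jump_computable f \<and> is_embedding f ?A (tree_struct B)) \<and>
      (\<exists>g. zero_jump_computable g \<and> is_embedding g (tree_struct B) ?A)"
    using F G F_rec G_rec unfolding zero_jump_computable_iff by blast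
qed

lemma path_embedding:
  assumes p: "is_path B p"
  shows "\<exists>h. is_embedding h (tree_struct B) (tree_struct B) \<and> 0 \<notin> range h"
proof -
  define on_path where "on_path k \<longleftrightarrow> (\<exists>t. k = \<langle>0, restr p t\<rangle>)" for k
  \<comment> \<open>Blocks on the path move one step along it and all others stay; elements keep
    their labels, which the larger block also contains.\<close>
  define s where "s k = (if on_path k then \<langle>0, restr p (Suc (lenc (psnd k)))\<rangle> else k)" for k
  define h where "h n = (if on_path (blk B n) then \<langle>psnd (s (blk B n)), psnd n\<rangle> else n)" for n
  have s_restr: "s \<langle>0, restr p t\<rangle> = \<langle>0, restr p (Suc t)\<rangle>" for t
    by (auto simp: s_def on_path_def)
  have restr_inj: "restr p t = restr p u \<longleftrightarrow> t = u" for t u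
    by (metis lenc_restr)
  have h: "lab B (h n) = lab B n \<and> blk B (h n) = s (blk B n)" for n
  proof (cases "on_path (blk B n)")
    case True
    then obtain t where t: "blk B n = \<langle>0, restr p t\<rangle>" by (auto simp: on_path_def)
    then have n: "tree_elem B n" "pfst n = restr p t" by (auto simp: blk_def split: if_splits)
    have "h n = \<langle>restr p (Suc t), psnd n\<rangle>" using True by (simp add: h_def t s_restr)
    moreover have "tree_elem B \<langle>restr p (Suc t), psnd n\<rangle>"
      using n node_restr[OF p] prefix_code_trans[OF _ prefix_code_restr[of t "Suc t" p]]
      by (simp add: tree_elem_def)
    ultimately show ?thesis using n t by (simp add: lab_def blk_def s_restr)
  next
    case False
    then show ?thesis by (simp add: h_def s_def)
  qed
  have on_path_s: "on_path (s k) \<longleftrightarrow> on_path k" for k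
    by (auto simp: s_def on_path_def)
  have s_inj: "s k = s l \<longleftrightarrow> k = l" for k l
  proof
    assume eq: "s k = s l"
    show "k = l"
    proof (cases "on_path k")
      case True
      then have "on_path l" using eq on_path_s by metis
      with True eq show ?thesis by (auto simp: on_path_def s_restr restr_inj)
    next
      case False
      then have "\<not> on_path l" using eq on_path_s by metis
      with False eq show ?thesis by (simp add: s_def)
    qed
  qed simp
  have "is_embedding h (tree_struct B) (tree_struct B)"
    by (rule tree_struct_embeddingI) (simp_all add: h s_inj)
  moreover have "h n \<noteq> 0" for n
  proof
    assume "h n = 0"
    \<comment> \<open>0 codes the empty sequence labelled by itself, so its block is the root, which
      the shift never reaches.\<close>
    have "0 = \<langle>restr p 0, restr p 0\<rangle>" by (simp add: restr_def prod_encode_def)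
    moreover have "tree_elem B \<langle>restr p 0, restr p 0\<rangle>"
      using node_restr[OF p] prefix_code_restr[of 0 0 p] by (simp add: tree_elem_def)
    ultimately have "blk B 0 = \<langle>0, restr p 0\<rangle>" by (metis blk_def fst_conv prod_encode_inverse)
    then have eq: "s (blk B n) = \<langle>0, restr p 0\<rangle>" using h[of n] \<open>h n = 0\<close> by simp
    then have "on_path (blk B n)" using on_path_s by (metis on_path_def)
    with eq show False by (auto simp: on_path_def s_restr restr_inj)
  qed
  ultimately show ?thesis by (metis rangeE)
qed

lemma not_categorical_if_path:
  assumes B: "recp {no_oracle} (\<lambda>f. B)" and path: "is_path B p"
    and not_computable: "\<And>h. is_path B h \<Longrightarrow> \<not> zero_jump_computable h"
  shows "\<not> zero_jump_cbe_categorical (tree_struct B)"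
proof
  assume cat: "zero_jump_cbe_categorical (tree_struct B)"
  \<comment> \<open>The tree structure with the root's element 0 deleted, renumbered through
    \<open>Suc\<close>.\<close>
  define A :: struc where "A i xs \<longleftrightarrow> tree_struct B i (map Suc xs)" for i xs
  have "recp {no_oracle} (\<lambda>f z. B (pfst z))"
    using recp_comp[OF B, of "\<lambda>f z. pfst z"] by (simp add: rec_intros)
  from recp_tree_struct[OF this, of Suc]
  have "recp {no_oracle} (\<lambda>f z. A (pfst (psnd z)) (list_decode (psnd (psnd z))))"
    by (simp add: A_def rec_intros)
  from ex_structure_indices[OF this] obtain a where a: "is_structure_index a" "struct_of a = A"
    by blast
  obtain h where h: "is_embedding h (tree_struct B) (tree_struct B)" "0 \<notin> range h"
    using path_embedding[OF path] by blast
  have Suc_h: "Suc (h n - 1) = h n" for n using h(2) by (metis Suc_pred' not_gr_zero rangeI)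
  have "inj (\<lambda>n. h n - 1)"
  proof (rule injI)
    fix x y assume "h x - 1 = h y - 1"
    then have "Suc (h x - 1) = Suc (h y - 1)" by simp
    then have "h x = h y" unfolding Suc_h .
    then show "x = y" using h(1) by (simp add: is_embedding_def inj_eq)
  qed
  moreover have comp: "Suc \<circ> (\<lambda>n. h n - 1) = h"
    unfolding fun_eq_iff o_apply using Suc_h by blast
  ultimately have "is_embedding (\<lambda>n. h n - 1) (tree_struct B) A"
    using h(1) unfolding is_embedding_def A_def map_map comp by simp
  moreover have incl: "is_embedding Suc A (tree_struct B)"
    by (simp add: is_embedding_def A_def)
  ultimately have "bi_embeddable (struct_of a) (tree_struct B)"
    unfolding a(2) bi_embeddable_def by blast
  then obtain g where g: "zero_jump_computable g" "is_embedding g (tree_struct B) A"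
    using cat a unfolding zero_jump_cbe_categorical_def by metis
  let ?k = "Suc \<circ> g"
  have k: "is_embedding ?k (tree_struct B) (tree_struct B)"
    by (rule is_embedding_comp[OF g(2) incl])
  \<comment> \<open>0 is not a value of \<open>Suc\<close>, so it moves; its label is kept, so its
    block must change.\<close>
  have "blk B (?k 0) \<noteq> blk B 0"
    using lab_blk_inj tree_struct_embeddingD(1)[OF k, of 0] by fastforce
  from path_of_embedding[OF k this]
  have "is_path B (\<lambda>j. nthc (pfst ((?k ^^ Suc j) 0)) j)" .
  \<comment> \<open>The path is read off from iterates of the embedding, so it is computable from
    the halting problem whenever \<open>g\<close> is.\<close>
  moreover have "zero_jump_computable (\<lambda>j. nthc (pfst ((?k ^^ Suc j) 0)) j)"
    using g(1) unfolding zero_jump_computable_iff o_def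
    by (intro rec_intros) (rule recf_comp, assumption, intro rec_intros)
  ultimately show False using not_computable by blast
qed

theorem theorem4p2:
  shows "Pi11_complete {e. is_structure_index e \<and> zero_jump_cbe_categorical (struct_of e)}"
  unfolding Pi11_complete_def
proof (intro conjI allI impI)
  show "Pi11 {e. is_structure_index e \<and> zero_jump_cbe_categorical (struct_of e)}"
    by (rule Pi11_categorical)
next
  fix T assume "Pi11 T"
  then obtain D where D: "\<forall>\<O>. recp \<O> (\<lambda>f z. D (pfst z) (psnd z))"
    and T: "\<And>x. x \<in> T \<longleftrightarrow> (\<forall>h. \<exists>t. D (restr h t) x)"
    and not_computable: "\<And>x h. \<forall>t. \<not> D (restr h t) x \<Longrightarrow> \<not> zero_jump_computable h"
    by (rule Pi11_avoiding_zero_jump) (rule that)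
  have B: "recp \<O> (\<lambda>f s. D s x)" for \<O> x
    using recp_comp[OF spec[OF D], of \<O> "\<lambda>f s. \<langle>s, x\<rangle>"] by (simp add: rec_intros)
  \<comment> \<open>Paths of the tree for \<open>x\<close> are the functions \<open>h\<close> on
    which the search never succeeds, so one exists just when \<open>x\<close> is not in
    \<open>T\<close>.\<close>
  have T_iff: "x \<in> T \<longleftrightarrow> zero_jump_cbe_categorical (tree_struct (\<lambda>s. D s x))" for x
  proof (cases "\<exists>h. is_path (\<lambda>s. D s x) h")
    case True
    then obtain h where h: "is_path (\<lambda>s. D s x) h" ..
    then have "x \<notin> T" by (auto simp: T is_path_def)
    then show ?thesis
      using not_categorical_if_path[OF B h] not_computable by (auto simp: is_path_def)
  next
    case False
    then have "x \<in> T" by (auto simp: T is_path_def)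
    then show ?thesis using categorical_if_no_path[OF _ False] B by blast
  qed
  obtain p where "\<forall>x. \<exists>e. ev no_oracle p x e \<and> is_structure_index e \<and>
      struct_of e = tree_struct (\<lambda>s. D s x)"
    using ex_structure_indices[of "\<lambda>x. tree_struct (\<lambda>s. D s x)"]
      recp_tree_struct[OF spec[OF D], of _ "\<lambda>n. n"] by (auto simp: rec_intros)
  then show "m_reducible T {e. is_structure_index e \<and> zero_jump_cbe_categorical (struct_of e)}"
    unfolding m_reducible_def T_iff by (metis mem_Collect_eq)
qed

end
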